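(* Consider the markets $\mathcal{M}_\alpha=\mathsf{FPPE}(b,v,s_\alpha,\Theta)$, $\alpha\in[0,1]$, with $s_\alpha=\alpha s'+(1-\alpha)s$, and write $\beta^*=\beta^*_0$. Suppose that (i) (smoothness in $\mathcal{M}_0$) the map $\beta\mapsto\int_\Theta \max_i\beta_i v_i(\theta)\,s(\theta)\,d\theta$ is twice continuously differentiable in a neighborhood of $\beta^*$; (ii) (strict complementary slackness in $\mathcal{M}_0$) for every buyer $i$, if $\beta^*_i=1$ then the leftover budget of buyer $i$ in $\mathcal{M}_0$ satisfies $\delta^*_i>0$; (iii) the map $\beta\mapsto\nabla^2\int_\Theta F(\theta,\beta)s'(\theta)\,d\theta$ is twice continuously differentiable in a neighborhood of $\beta^*$. Then the directional derivative $d\beta^*(\alpha)=\lim_{\epsilon\to0^+}(\beta^*_{\alpha-\epsilon}-\beta^*_\alpha)/\epsilon$ is well-defined for all $\alpha$ in a neighborhood of zero, and there it is given by $$d\beta^*(\alpha)=-(P_\alpha \mathcal{H}_\alpha P_\alpha)^\dagger\,\delta_\alpha .$$ Moreover, the debiased surrogate $\widetilde\beta^*=\beta^*_\alpha-\alpha\,(P_\alpha \mathcal{H}_\alpha P_\alpha)^\dagger\delta_\alpha$ (which depends on $\alpha$) satisfies, as $\alpha\downarrow0$, $$\|\widetilde\beta^*-\beta^*\|_2=o(\alpha).$$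
   Context: **Market.** $(\Theta,d\theta)$ is a measurable space with a base measure. There are $n$ buyers; buyer $i$ has budget $b_i>0$ and valuation $v_i:\Theta\to[0,\infty)$, $v_i\in L^1_+$, with $\max_i\sup_\theta v_i(\theta)<\infty$. The item set is partitioned as $\Theta=\Theta_{good}\cup\Theta_{bad}$. The supplies $s,s'\in L^\infty_+$ satisfy $\int s\,d\theta=\int s'\,d\theta=1$; $s$ is supported on $\Theta_{good}$ and $s'$ on $\Theta_{bad}$. For $\alpha\in[0,1]$, $s_\alpha=\alpha s'+(1-\alpha)s$. **First-price pacing equilibrium.** For a supply $r$, $\mathsf{FPPE}(b,v,r,\Theta)$ is the unique pair $(\beta,p)\in[0,1]^n\times L^1_+(\Theta)$ for which there exist allocations $x_i:\Theta\to[0,1]$ with: (1) for all $\theta$, $p(\theta)=\max_i\beta_iv_i(\theta)$, and $x_i(\theta)>0$ implies $\beta_iv_i(\theta)=\max_k\beta_kv_k(\theta)$; (2) $\int x_i p\, r\,d\theta\le b_i$ for all $i$, $\sum_i x_i(\theta)\le1$ for all $\theta$, and $p(\theta)>0$ implies $\sum_ix_i(\theta)=1$; (3) $\int x_i p\,r\,d\theta<b_i$ implies $\beta_i=1$. The leftover budget of buyer $i$ is $\delta^*_i=b_i-\int p\,x_i\,r\,d\theta$, evaluated at equilibrium. (As usual, functions are identified up to null sets.) **Eisenberg–Gale program.** Let $f(\theta,\beta)=\max_{i}\beta_iv_i(\theta)$ and $F(\theta,\beta)=f(\theta,\beta)-\sum_{i=1}^nb_i\log\beta_i$. The equilibrium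 pacing multiplier vector of $\mathcal{M}_\alpha$, denoted $\beta^*_\alpha$, is the unique minimizer of $H_\alpha(\beta)=\int_\Theta F(\theta,\beta)s_\alpha(\theta)\,d\theta$ over $(0,1]^n$. For $\alpha<0$ close to $0$, $\beta^*_\alpha$ denotes the minimizer of the same function $H_\alpha$ over $(0,1]^n$ (with $s_\alpha$ given by the same formula, a signed density); for such $\alpha$ its existence and uniqueness is part of the assertion that $d\beta^*$ is well-defined. **Other notation.** $\mathcal{H}_\alpha=\nabla^2_{\beta\beta}H_\alpha(\beta^*_\alpha)$; $P_\alpha=\mathrm{Diag}(1(\beta^*_{\alpha,i}<1))$ is the diagonal $0/1$ matrix; $\delta_\alpha=\int_\Theta\nabla_\beta f(\theta,\beta^*_\alpha)\,(s(\theta)-s'(\theta))\,d\theta\in\mathbb{R}^n$ (a vector, not to be confused with the leftover budgets $\delta_i^*$); $A^\dagger$ is the Moore–Penrose inverse. *)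

theory Defs
  imports "HOL-Analysis.Analysis" "HOL-Library.Landau_Symbols"
begin

section \<open>Calculus on Euclidean spaces\<close>

definition C2_on :: "('a::real_normed_vector \<Rightarrow> 'b::real_normed_vector) \<Rightarrow> 'a set \<Rightarrow> bool" where
  "C2_on g U \<longleftrightarrow>
     (\<exists>(g' :: 'a \<Rightarrow> 'a \<Rightarrow>\<^sub>L 'b) (g'' :: 'a \<Rightarrow> 'a \<Rightarrow>\<^sub>L ('a \<Rightarrow>\<^sub>L 'b)).
        (\<forall>x\<in>U. (g has_derivative blinfun_apply (g' x)) (at x)) \<and>
        (\<forall>x\<in>U. (g' has_derivative blinfun_apply (g'' x)) (at x)) \<and>
        continuous_on U g'')"

definition grad :: "('a::real_inner \<Rightarrow> real) \<Rightarrow> 'a \<Rightarrow> 'a" where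
  "grad g x = (THE D. GDERIV g x :> D)"

definition hess :: "(real^'n \<Rightarrow> real) \<Rightarrow> real^'n \<Rightarrow> real^'n^'n" where
  "hess g x = jacobian (grad g) (at x)"

definition is_moore_penrose :: "real^'n^'m \<Rightarrow> real^'m^'n \<Rightarrow> bool" where
  "is_moore_penrose A X \<longleftrightarrow>
     A ** X ** A = A \<and> X ** A ** X = X \<and>
     transpose (A ** X) = A ** X \<and> transpose (X ** A) = X ** A"

definition pinv :: "real^'n^'m \<Rightarrow> real^'m^'n" where
  "pinv A = (THE X. is_moore_penrose A X)"

section \<open>First-price pacing equilibrium\<close>

definition L1_plus :: "'t measure \<Rightarrow> ('t \<Rightarrow> real) \<Rightarrow> bool" where
  "L1_plus M g \<longleftrightarrow> integrable M g \<and> (AE \<theta> in M. 0 \<le> g \<theta>)"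

definition Linf_plus :: "'t measure \<Rightarrow> ('t \<Rightarrow> real) \<Rightarrow> bool" where
  "Linf_plus M g \<longleftrightarrow> g \<in> borel_measurable M \<and> (\<exists>C. AE \<theta> in M. 0 \<le> g \<theta> \<and> g \<theta> \<le> C)"

definition max_bid :: "('n::finite \<Rightarrow> 't \<Rightarrow> real) \<Rightarrow> 't \<Rightarrow> real^'n \<Rightarrow> real" where
  "max_bid v \<theta> \<beta> = (MAX i. \<beta> $ i * v i \<theta>)"

definition spend :: "'t measure \<Rightarrow> ('t \<Rightarrow> real) \<Rightarrow> ('t \<Rightarrow> real) \<Rightarrow> ('n \<Rightarrow> 't \<Rightarrow> real) \<Rightarrow> 'n \<Rightarrow> real" where
  "spend M r p x i = (\<integral>\<theta>. x i \<theta> * p \<theta> * r \<theta> \<partial>M)"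

definition leftover ::
  "'t measure \<Rightarrow> real^'n \<Rightarrow> ('t \<Rightarrow> real) \<Rightarrow> ('t \<Rightarrow> real) \<Rightarrow> ('n \<Rightarrow> 't \<Rightarrow> real) \<Rightarrow> 'n \<Rightarrow> real" where
  "leftover M b r p x i = b $ i - spend M r p x i"

text \<open>
  Prices and allocations are identified up to null sets of the base measure, hence the
  almost-everywhere quantifiers.
\<close>

definition fppe ::
  "'t measure \<Rightarrow> real^'n \<Rightarrow> ('n::finite \<Rightarrow> 't \<Rightarrow> real) \<Rightarrow> ('t \<Rightarrow> real) \<Rightarrow>
   real^'n \<Rightarrow> ('t \<Rightarrow> real) \<Rightarrow> ('n \<Rightarrow> 't \<Rightarrow> real) \<Rightarrow> bool" where
  "fppe M b v r \<beta> p x \<longleftrightarrow>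
     (\<forall>i. 0 \<le> \<beta> $ i \<and> \<beta> $ i \<le> 1) \<and> L1_plus M p \<and>
     (\<forall>i. x i \<in> borel_measurable M \<and> (AE \<theta> in M. 0 \<le> x i \<theta> \<and> x i \<theta> \<le> 1)) \<and>
     (AE \<theta> in M. p \<theta> = max_bid v \<theta> \<beta>) \<and>
     (\<forall>i. AE \<theta> in M. 0 < x i \<theta> \<longrightarrow> \<beta> $ i * v i \<theta> = max_bid v \<theta> \<beta>) \<and>
     (\<forall>i. spend M r p x i \<le> b $ i) \<and>
     (AE \<theta> in M. (\<Sum>i\<in>UNIV. x i \<theta>) \<le> 1) \<and>
     (AE \<theta> in M. 0 < p \<theta> \<longrightarrow> (\<Sum>i\<in>UNIV. x i \<theta>) = 1) \<and>
     (\<forall>i. spend M r p x i < b $ i \<longrightarrow> \<beta> $ i = 1)"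

text \<open>
  The multipliers and prices of an equilibrium are unique, its allocations need not be.
  Strict complementary slackness is therefore required of every supporting allocation;
  when \<open>\<beta> \<mapsto> \<integral> max_bid v \<theta> \<beta> * r \<theta> \<partial>M\<close> is differentiable at the equilibrium multipliers, the
  leftover budgets do not depend on that choice.
\<close>

definition strict_comp_slack ::
  "'t measure \<Rightarrow> real^'n \<Rightarrow> ('n::finite \<Rightarrow> 't \<Rightarrow> real) \<Rightarrow> ('t \<Rightarrow> real) \<Rightarrow> bool" where
  "strict_comp_slack M b v r \<longleftrightarrow>
     (\<forall>\<beta> p x. fppe M b v r \<beta> p x \<longrightarrow> (\<forall>i. \<beta> $ i = 1 \<longrightarrow> 0 < leftover M b r p x i))"

section \<open>Eisenberg--Gale program\<close>

definition eg_integrand ::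
  "real^'n \<Rightarrow> ('n::finite \<Rightarrow> 't \<Rightarrow> real) \<Rightarrow> 't \<Rightarrow> real^'n \<Rightarrow> real" where
  "eg_integrand b v \<theta> \<beta> = max_bid v \<theta> \<beta> - (\<Sum>i\<in>UNIV. b $ i * ln (\<beta> $ i))"

definition eg_objective ::
  "'t measure \<Rightarrow> real^'n \<Rightarrow> ('n::finite \<Rightarrow> 't \<Rightarrow> real) \<Rightarrow> ('t \<Rightarrow> real) \<Rightarrow> real^'n \<Rightarrow> real" where
  "eg_objective M b v r \<beta> = (\<integral>\<theta>. eg_integrand b v \<theta> \<beta> * r \<theta> \<partial>M)"

definition is_eg_minimizer ::
  "'t measure \<Rightarrow> real^'n \<Rightarrow> ('n::finite \<Rightarrow> 't \<Rightarrow> real) \<Rightarrow> ('t \<Rightarrow> real) \<Rightarrow> real^'n \<Rightarrow> bool" where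
  "is_eg_minimizer M b v r \<beta> \<longleftrightarrow>
     is_arg_min (eg_objective M b v r) (\<lambda>\<gamma>. \<forall>i. 0 < \<gamma> $ i \<and> \<gamma> $ i \<le> 1) \<beta>"

text \<open>
  For a supply \<open>r\<close> the minimizer is the vector of equilibrium multipliers, see
  \<open>fppe_imp_pacing\<close> below; it remains meaningful when \<open>r\<close> is a signed density.
\<close>

definition pacing ::
  "'t measure \<Rightarrow> real^'n \<Rightarrow> ('n::finite \<Rightarrow> 't \<Rightarrow> real) \<Rightarrow> ('t \<Rightarrow> real) \<Rightarrow> real^'n" where
  "pacing M b v r = (THE \<beta>. is_eg_minimizer M b v r \<beta>)"

definition mix_supply :: "('t \<Rightarrow> real) \<Rightarrow> ('t \<Rightarrow> real) \<Rightarrow> real \<Rightarrow> 't \<Rightarrow> real" where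
  "mix_supply s s' \<alpha> \<theta> = \<alpha> * s' \<theta> + (1 - \<alpha>) * s \<theta>"

definition unpaced_proj :: "real^'n \<Rightarrow> real^'n^'n" where
  "unpaced_proj \<beta> = (\<chi> i j. if i = j \<and> \<beta> $ i < 1 then 1 else 0)"

definition supply_shift ::
  "'t measure \<Rightarrow> ('n::finite \<Rightarrow> 't \<Rightarrow> real) \<Rightarrow> ('t \<Rightarrow> real) \<Rightarrow> ('t \<Rightarrow> real) \<Rightarrow> real^'n \<Rightarrow> real^'n" where
  "supply_shift M v s s' \<beta> = (\<integral>\<theta>. (s \<theta> - s' \<theta>) *\<^sub>R grad (max_bid v \<theta>) \<beta> \<partial>M)"

text \<open>The vector \<open>(P \<H> P)\<^sup>\<dagger> \<delta>\<close> evaluated at the multipliers of the mixed market.\<close>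

definition surrogate_correction ::
  "'t measure \<Rightarrow> real^'n \<Rightarrow> ('n::finite \<Rightarrow> 't \<Rightarrow> real) \<Rightarrow> ('t \<Rightarrow> real) \<Rightarrow> ('t \<Rightarrow> real) \<Rightarrow>
   real \<Rightarrow> real^'n" where
  "surrogate_correction M b v s s' \<alpha> =
     (let r = mix_supply s s' \<alpha>; \<beta> = pacing M b v r; P = unpaced_proj \<beta>;
          H = hess (eg_objective M b v r) \<beta>
      in pinv (P ** H ** P) *v supply_shift M v s s' \<beta>)"

section \<open>Equilibrium multipliers minimize the Eisenberg--Gale objective\<close>

lemma max_bid_ge: "\<beta> $ i * v i \<theta> \<le> max_bid v \<theta> \<beta>"
  unfolding max_bid_def by (rule Max_ge) auto

lemma max_bid_measurable:
  fixes v :: "'n::finite \<Rightarrow> 't \<Rightarrow> real"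
  assumes "\<And>i. v i \<in> borel_measurable M"
  shows "(\<lambda>\<theta>. max_bid v \<theta> \<beta>) \<in> borel_measurable M"
  unfolding max_bid_def
  using assms by (intro borel_measurable_Max) auto

lemma max_bid_bound:
  fixes v :: "'n::finite \<Rightarrow> 't \<Rightarrow> real"
  shows "\<bar>max_bid v \<theta> \<beta>\<bar> \<le> (\<Sum>i\<in>UNIV. \<bar>\<beta> $ i\<bar> * \<bar>v i \<theta>\<bar>)"
proof -
  have "max_bid v \<theta> \<beta> \<in> range (\<lambda>i. \<beta> $ i * v i \<theta>)"
    unfolding max_bid_def by (rule Max_in) auto
  then obtain i where "max_bid v \<theta> \<beta> = \<beta> $ i * v i \<theta>" by auto
  then have "\<bar>max_bid v \<theta> \<beta>\<bar> = \<bar>\<beta> $ i\<bar> * \<bar>v i \<theta>\<bar>" by (simp add: abs_mult)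
  also have "\<dots> \<le> (\<Sum>i\<in>UNIV. \<bar>\<beta> $ i\<bar> * \<bar>v i \<theta>\<bar>)"
    by (rule member_le_sum) auto
  finally show ?thesis .
qed

lemma integrable_mult_Linf_plus:
  fixes g :: "'t \<Rightarrow> real"
  assumes "integrable M g" "Linf_plus M r"
  shows "integrable M (\<lambda>\<theta>. g \<theta> * r \<theta>)"
proof -
  obtain C where C: "AE \<theta> in M. 0 \<le> r \<theta> \<and> r \<theta> \<le> C" and [measurable]: "r \<in> borel_measurable M"
    using assms(2) unfolding Linf_plus_def by auto
  show ?thesis
  proof (rule Bochner_Integration.integrable_bound)
    show "integrable M (\<lambda>\<theta>. C * g \<theta>)" using assms(1) by simp
    show "(\<lambda>\<theta>. g \<theta> * r \<theta>) \<in> borel_measurable M" using assms(1) by measurable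
    show "AE \<theta> in M. norm (g \<theta> * r \<theta>) \<le> norm (C * g \<theta>)"
      using C by eventually_elim (auto simp: abs_mult mult.commute intro!: mult_right_mono)
  qed
qed

lemma integrable_max_bid:
  fixes v :: "'n::finite \<Rightarrow> 't \<Rightarrow> real"
  assumes "\<And>i. integrable M (v i)"
  shows "integrable M (\<lambda>\<theta>. max_bid v \<theta> \<beta>)"
proof (rule Bochner_Integration.integrable_bound)
  show "integrable M (\<lambda>\<theta>. \<Sum>i\<in>UNIV. \<bar>\<beta> $ i\<bar> * \<bar>v i \<theta>\<bar>)"
    using assms by (intro Bochner_Integration.integrable_sum integrable_mult_right integrable_abs)
  show "(\<lambda>\<theta>. max_bid v \<theta> \<beta>) \<in> borel_measurable M"
    using assms by (intro max_bid_measurable) auto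
  show "AE \<theta> in M. norm (max_bid v \<theta> \<beta>) \<le> norm (\<Sum>i\<in>UNIV. \<bar>\<beta> $ i\<bar> * \<bar>v i \<theta>\<bar>)"
    using max_bid_bound[of v _ \<beta>] by (auto simp: abs_of_nonneg sum_nonneg)
qed

lemma eg_objective_eq:
  fixes v :: "'n::finite \<Rightarrow> 't \<Rightarrow> real"
  assumes "\<And>i. integrable M (v i)" "Linf_plus M r" "(\<integral>\<theta>. r \<theta> \<partial>M) = 1"
  shows "eg_objective M b v r \<gamma> =
           (\<integral>\<theta>. max_bid v \<theta> \<gamma> * r \<theta> \<partial>M) - (\<Sum>i\<in>UNIV. b $ i * ln (\<gamma> $ i))"
proof -
  have "integrable M r" using assms(3) by (metis not_integrable_integral_eq zero_neq_one)
  moreover have "integrable M (\<lambda>\<theta>. max_bid v \<theta> \<gamma> * r \<theta>)"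
    using assms by (intro integrable_mult_Linf_plus integrable_max_bid)
  ultimately show ?thesis
    using assms(3) by (simp add: eg_objective_def eg_integrand_def left_diff_distrib)
qed

lemma log_barrier_min:
  fixes b c \<beta> \<gamma> :: real
  assumes "0 < b" "0 < \<beta>" "0 < \<gamma>" "\<gamma> \<le> 1" "\<beta> \<le> 1" "\<beta> * c \<le> b" "\<beta> * c < b \<longrightarrow> \<beta> = 1"
  shows "\<beta> * c - b * ln \<beta> \<le> \<gamma> * c - b * ln \<gamma>"
    and "\<gamma> \<noteq> \<beta> \<Longrightarrow> \<beta> * c - b * ln \<beta> < \<gamma> * c - b * ln \<gamma>"
proof -
  define u where "u = \<gamma> / \<beta>"
  have u: "0 < u" "\<gamma> = u * \<beta>" using assms by (auto simp: u_def)
  have "(b - \<beta> * c) * (u - 1) \<le> 0"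
  proof (cases "\<beta> * c < b")
    case True
    then have "u \<le> 1" using assms by (simp add: u_def)
    then show ?thesis using True by (simp add: mult_nonneg_nonpos)
  qed (use assms in auto)
  then have "b * (u - 1) \<le> \<beta> * c * (u - 1)" by (simp add: algebra_simps)
  moreover have "ln \<gamma> = ln u + ln \<beta>" using u assms by (simp add: ln_mult)
  ultimately have *: "(\<gamma> * c - b * ln \<gamma>) - (\<beta> * c - b * ln \<beta>) \<ge> b * (u - 1 - ln u)"
    using u by (simp add: algebra_simps)
  have "ln u \<le> u - 1" using u by (simp add: ln_le_minus_one)
  then have "0 \<le> b * (u - 1 - ln u)" using assms by simp
  then show "\<beta> * c - b * ln \<beta> \<le> \<gamma> * c - b * ln \<gamma>" using * by linarith
  assume "\<gamma> \<noteq> \<beta>"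
  then have "u \<noteq> 1" using u by auto
  then have "ln u \<noteq> u - 1" using ln_eq_minus_one[of u] u by auto
  then have "0 < b * (u - 1 - ln u)" using assms \<open>ln u \<le> u - 1\<close> by simp
  then show "\<beta> * c - b * ln \<beta> < \<gamma> * c - b * ln \<gamma>" using * by linarith
qed

theorem fppe_imp_pacing:
  fixes v :: "'n::finite \<Rightarrow> 't \<Rightarrow> real"
  assumes b: "\<And>i. 0 < b $ i"
    and v: "\<And>i. L1_plus M (v i)"
    and r: "Linf_plus M r" "(\<integral>\<theta>. r \<theta> \<partial>M) = 1"
    and eq: "fppe M b v r \<beta> p x"
  shows "is_eg_minimizer M b v r \<beta>" and "\<beta> = pacing M b v r"
proof -
  have vint: "\<And>i. integrable M (v i)" and vnn: "\<And>i. AE \<theta> in M. 0 \<le> v i \<theta>"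
    using v by (auto simp: L1_plus_def)
  have vall: "AE \<theta> in M. \<forall>i. 0 \<le> v i \<theta>"
    using vnn by (simp add: AE_all_countable)
  have rnn: "AE \<theta> in M. 0 \<le> r \<theta>" using r(1) unfolding Linf_plus_def by auto
  have box: "\<And>i. 0 \<le> \<beta> $ i \<and> \<beta> $ i \<le> 1"
    and pint: "integrable M p"
    and xm: "\<And>i. x i \<in> borel_measurable M"
    and peq: "AE \<theta> in M. p \<theta> = max_bid v \<theta> \<beta>"
    and bud: "\<And>i. spend M r p x i \<le> b $ i"
    and xs: "AE \<theta> in M. (\<Sum>i\<in>UNIV. x i \<theta>) \<le> 1"
    and clear: "AE \<theta> in M. 0 < p \<theta> \<longrightarrow> (\<Sum>i\<in>UNIV. x i \<theta>) = 1"
    and cs: "\<And>i. spend M r p x i < b $ i \<longrightarrow> \<beta> $ i = 1"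
    and pnn: "AE \<theta> in M. 0 \<le> p \<theta>"
    using eq unfolding fppe_def L1_plus_def by auto
  have xb: "AE \<theta> in M. \<forall>i. 0 \<le> x i \<theta> \<and> x i \<theta> \<le> 1"
    and win: "AE \<theta> in M. \<forall>i. 0 < x i \<theta> \<longrightarrow> \<beta> $ i * v i \<theta> = max_bid v \<theta> \<beta>"
    using eq unfolding fppe_def by (simp_all add: AE_all_countable)
  define c where "c i = (\<integral>\<theta>. x i \<theta> * v i \<theta> * r \<theta> \<partial>M)" for i
  have xvint: "integrable M (\<lambda>\<theta>. x i \<theta> * v i \<theta>)" for i
  proof (rule Bochner_Integration.integrable_bound[OF vint[of i]])
    show "(\<lambda>\<theta>. x i \<theta> * v i \<theta>) \<in> borel_measurable M" using xm vint[of i] by measurable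
    show "AE \<theta> in M. norm (x i \<theta> * v i \<theta>) \<le> norm (v i \<theta>)"
      using xb by eventually_elim (auto simp: abs_mult intro!: mult_left_le_one_le)
  qed
  have xvrint: "integrable M (\<lambda>\<theta>. x i \<theta> * v i \<theta> * r \<theta>)" for i
    by (rule integrable_mult_Linf_plus[OF xvint r(1)])
  have rm[measurable]: "r \<in> borel_measurable M" using r(1) unfolding Linf_plus_def by auto
  have xpr: "AE \<theta> in M. \<forall>i. x i \<theta> * p \<theta> * r \<theta> = \<beta> $ i * (x i \<theta> * v i \<theta> * r \<theta>)"
    using xb win peq
  proof eventually_elim
    case (elim \<theta>)
    have "x i \<theta> * p \<theta> * r \<theta> = \<beta> $ i * (x i \<theta> * v i \<theta> * r \<theta>)" for i
    proof (cases "x i \<theta> = 0")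
      case False
      then have "0 < x i \<theta>" using elim(1) by (metis order_less_le)
      then have "p \<theta> = \<beta> $ i * v i \<theta>" using elim by simp
      then show ?thesis by simp
    qed simp
    then show ?case by blast
  qed
  have sp: "spend M r p x i = \<beta> $ i * c i" for i
  proof -
    have "spend M r p x i = (\<integral>\<theta>. \<beta> $ i * (x i \<theta> * v i \<theta> * r \<theta>) \<partial>M)"
      unfolding spend_def
    proof (rule integral_cong_AE)
      show "(\<lambda>\<theta>. x i \<theta> * p \<theta> * r \<theta>) \<in> borel_measurable M" using xm pint by measurable
      show "(\<lambda>\<theta>. \<beta> $ i * (x i \<theta> * v i \<theta> * r \<theta>)) \<in> borel_measurable M"
        using xvrint[of i] by measurable
      show "AE \<theta> in M. x i \<theta> * p \<theta> * r \<theta> = \<beta> $ i * (x i \<theta> * v i \<theta> * r \<theta>)"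
        using xpr by eventually_elim auto
    qed
    then show ?thesis by (simp add: c_def)
  qed
  have bpos: "0 < \<beta> $ i" for i
  proof (rule ccontr)
    assume "\<not> 0 < \<beta> $ i"
    then have "\<beta> $ i = 0" using box[of i] by linarith
    then show False using cs[of i] sp[of i] b[of i] by simp
  qed
  define K where "K \<gamma> = (\<Sum>i\<in>UNIV. \<gamma> $ i * c i - b $ i * ln (\<gamma> $ i))" for \<gamma> :: "real^'n"
  have sumc: "(\<Sum>i\<in>UNIV. \<gamma> $ i * c i) = (\<integral>\<theta>. (\<Sum>i\<in>UNIV. \<gamma> $ i * (x i \<theta> * v i \<theta> * r \<theta>)) \<partial>M)"
    for \<gamma> :: "real^'n"
    using xvrint by (subst Bochner_Integration.integral_sum) (auto simp: c_def)
  have mbint: "integrable M (\<lambda>\<theta>. max_bid v \<theta> \<gamma> * r \<theta>)" for \<gamma>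
    by (rule integrable_mult_Linf_plus[OF integrable_max_bid[OF vint] r(1)])
  have lower: "K \<gamma> \<le> eg_objective M b v r \<gamma>" if g: "\<And>i. 0 < \<gamma> $ i" for \<gamma> :: "real^'n"
  proof -
    have "(\<Sum>i\<in>UNIV. \<gamma> $ i * c i) \<le> (\<integral>\<theta>. max_bid v \<theta> \<gamma> * r \<theta> \<partial>M)"
      unfolding sumc
    proof (rule integral_mono_AE)
      show "integrable M (\<lambda>\<theta>. \<Sum>i\<in>UNIV. \<gamma> $ i * (x i \<theta> * v i \<theta> * r \<theta>))"
        using xvrint by (intro Bochner_Integration.integrable_sum integrable_mult_right)
      show "integrable M (\<lambda>\<theta>. max_bid v \<theta> \<gamma> * r \<theta>)" by (rule mbint)
      show "AE \<theta> in M. (\<Sum>i\<in>UNIV. \<gamma> $ i * (x i \<theta> * v i \<theta> * r \<theta>)) \<le> max_bid v \<theta> \<gamma> * r \<theta>"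
        using xb xs vall rnn
      proof eventually_elim
        case (elim \<theta>)
        have "0 \<le> \<gamma> $ i * v i \<theta>" for i using elim g[of i] by (simp add: less_imp_le)
        then have m0: "0 \<le> max_bid v \<theta> \<gamma>" using max_bid_ge[of \<gamma> _ v \<theta>] by (meson order_trans)
        have "(\<Sum>i\<in>UNIV. x i \<theta> * (\<gamma> $ i * v i \<theta>)) \<le> (\<Sum>i\<in>UNIV. x i \<theta> * max_bid v \<theta> \<gamma>)"
          using elim by (intro sum_mono mult_left_mono max_bid_ge) auto
        also have "\<dots> = (\<Sum>i\<in>UNIV. x i \<theta>) * max_bid v \<theta> \<gamma>" by (simp add: sum_distrib_right)
        also have "\<dots> \<le> 1 * max_bid v \<theta> \<gamma>" using elim m0 by (intro mult_right_mono) auto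
        finally have "(\<Sum>i\<in>UNIV. x i \<theta> * (\<gamma> $ i * v i \<theta>)) * r \<theta> \<le> max_bid v \<theta> \<gamma> * r \<theta>"
          using elim by (intro mult_right_mono) auto
        then show ?case by (simp add: sum_distrib_left mult_ac)
      qed
    qed
    then show ?thesis using eg_objective_eq[OF vint r, where b = b and \<gamma> = \<gamma>]
      by (simp add: K_def sum_subtractf)
  qed
  have exact: "eg_objective M b v r \<beta> = K \<beta>"
  proof -
    have "(\<Sum>i\<in>UNIV. \<beta> $ i * c i) = (\<integral>\<theta>. max_bid v \<theta> \<beta> * r \<theta> \<partial>M)"
      unfolding sumc
    proof (rule integral_cong_AE)
      show "(\<lambda>\<theta>. \<Sum>i\<in>UNIV. \<beta> $ i * (x i \<theta> * v i \<theta> * r \<theta>)) \<in> borel_measurable M"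
        using xm vint rm by (intro borel_measurable_sum borel_measurable_times) auto
      show "(\<lambda>\<theta>. max_bid v \<theta> \<beta> * r \<theta>) \<in> borel_measurable M" using mbint by blast
      show "AE \<theta> in M. (\<Sum>i\<in>UNIV. \<beta> $ i * (x i \<theta> * v i \<theta> * r \<theta>)) = max_bid v \<theta> \<beta> * r \<theta>"
        using xpr peq clear pnn
      proof eventually_elim
        case (elim \<theta>)
        have "(\<Sum>i\<in>UNIV. \<beta> $ i * (x i \<theta> * v i \<theta> * r \<theta>)) = (\<Sum>i\<in>UNIV. x i \<theta>) * (p \<theta> * r \<theta>)"
          unfolding sum_distrib_right using elim(1) by (intro sum.cong refl) (metis mult.assoc)
        also have "\<dots> = p \<theta> * r \<theta>" using elim by (cases "p \<theta> = 0") auto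
        finally show ?case using elim by simp
      qed
    qed
    then show ?thesis using eg_objective_eq[OF vint r, where b = b and \<gamma> = \<beta>]
      by (simp add: K_def sum_subtractf)
  qed
  have bar: "\<beta> $ i * c i \<le> b $ i" "\<beta> $ i * c i < b $ i \<longrightarrow> \<beta> $ i = 1" for i
    using bud[of i] cs[of i] sp[of i] by auto
  have less: "eg_objective M b v r \<beta> < eg_objective M b v r \<gamma>"
    if g: "\<forall>i. 0 < \<gamma> $ i \<and> \<gamma> $ i \<le> 1" and ne: "\<gamma> \<noteq> \<beta>" for \<gamma>
  proof -
    obtain j where j: "\<gamma> $ j \<noteq> \<beta> $ j" using ne by (auto simp: vec_eq_iff)
    have "K \<beta> < K \<gamma>"
      unfolding K_def
    proof (rule sum_strict_mono_ex1)
      show "\<forall>i\<in>UNIV. \<beta> $ i * c i - b $ i * ln (\<beta> $ i) \<le> \<gamma> $ i * c i - b $ i * ln (\<gamma> $ i)"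
        using log_barrier_min(1) b bpos g box bar by blast
      show "\<exists>i\<in>UNIV. \<beta> $ i * c i - b $ i * ln (\<beta> $ i) < \<gamma> $ i * c i - b $ i * ln (\<gamma> $ i)"
        using log_barrier_min(2) b bpos g box bar j by blast
    qed simp
    then show ?thesis using lower[of \<gamma>] g exact by force
  qed
  show min: "is_eg_minimizer M b v r \<beta>"
    unfolding is_eg_minimizer_def is_arg_min_def
    using less bpos box by (metis order_less_asym)
  show "\<beta> = pacing M b v r"
    unfolding pacing_def
  proof (rule the_equality[where P = "is_eg_minimizer M b v r", OF min, symmetric])
    fix \<gamma> assume "is_eg_minimizer M b v r \<gamma>"
    then show "\<gamma> = \<beta>"
      unfolding is_eg_minimizer_def is_arg_min_def
      using less bpos box by metis
  qed
qed

end

theory Submission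
  imports Defs
begin

text \<open>
  The objective of the mixed market is affine in \<open>\<alpha>\<close>, and the objective at \<open>\<alpha> = 0\<close> is strongly
  convex on the unit box because of the logarithmic barrier. Hence minimizers exist for small
  \<open>\<alpha>\<close>, also when the supply is signed, and lie within \<open>O(\<bar>\<alpha>\<bar>\<^sup>1\<^sup>/\<^sup>2)\<close> of those at \<open>\<alpha> = 0\<close>.
  Awarding every item to one highest bidder yields a subgradient of the revenue, thus its gradient
  where it is differentiable; stationarity then makes this allocation an equilibrium, and strict
  complementary slackness says that the objective has a negative partial derivative in every
  multiplier that equals one. Near \<open>\<alpha> = 0\<close> those multipliers therefore stay at one, while the
  others satisfy the stationarity equations. There the Hessian is uniformly coercive, so testing the
  equations against differences of minimizers gives uniqueness, Lipschitz dependence on \<open>\<alpha>\<close>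
  and finally differentiability, with the derivative solving the linear system whose
  solution operator is the pseudoinverse of the compressed Hessian.
\<close>

section \<open>Calculus in inner product spaces\<close>

text \<open>The integrand is a maximum and has no gradient at ties; smoothness is available only for
  the integrated revenue, and only near the multipliers at \<alpha> = 0. Minimizers must therefore
  be localised before any derivative is taken, and the square-root bound, which uses no derivatives,
  does this. For \<alpha> < 0 the supply may be negative and the objective need not be convex; the
  curvature then comes from the barrier, whose Hessian is at least m/4 where the multipliers are
  below 2, with m the least budget. Half of it absorbs the part of the Hessian that carries the
  factor \<alpha>. The difference quotient steps backwards in \<alpha>, so the limit in the theorem
  is minus the ordinary derivative, and the ordinary derivative is the correction itself. The
  surrogate evaluates this correction at \<alpha> and not at 0, so the o(\<alpha>) claim rests on
  continuity of the derivative at 0 in addition to differentiability there.\<close>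

text \<open>Subtracting the affine minorant leaves a function with a global minimum at
  \<open>x\<close>, whose derivative vanishes; evaluating it in the direction \<open>D - h\<close>
  gives the claim.\<close>

lemma gderiv_eq_subgradient:
  fixes g :: "'a::real_inner \<Rightarrow> real"
  assumes "GDERIV g x :> D" and sub: "\<And>y. g x + h \<bullet> (y - x) \<le> g y"
  shows "D = h"
proof -
  have "((\<lambda>y. g y - h \<bullet> (y - x)) has_derivative (\<lambda>k. k \<bullet> D - h \<bullet> k)) (at x)"
    using assms(1) unfolding gderiv_def by (auto intro!: derivative_eq_intros)
  moreover have "g x - h \<bullet> (x - x) \<le> g y - h \<bullet> (y - x)" for y
    using sub[of y] by simp
  ultimately have "(\<lambda>k. k \<bullet> D - h \<bullet> k) = (\<lambda>k. 0)"
    by (intro has_derivative_local_min[where x = x and f = "\<lambda>y. g y - h \<bullet> (y - x)"] always_eventually allI)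
  then have "(D - h) \<bullet> D - h \<bullet> (D - h) = 0" by metis
  then have "(D - h) \<bullet> (D - h) = 0" by (simp add: inner_diff inner_commute)
  then show ?thesis by simp
qed

text \<open>\<open>T\<close> is the Riesz map in coordinates: it turns the derivative functional
  into a gradient vector and, being bounded linear, transports the second derivative and its
  continuity.\<close>

lemma C2_on_gradient:
  fixes g :: "real^'n \<Rightarrow> real"
  assumes "C2_on g U"
  obtains G D where "\<And>x. x \<in> U \<Longrightarrow> GDERIV g x :> G x"
    and "\<And>x. x \<in> U \<Longrightarrow> (G has_derivative blinfun_apply (D x)) (at x)"
    and "continuous_on U D"
proof -
  obtain g' and g'' :: "real^'n \<Rightarrow> (real^'n) \<Rightarrow>\<^sub>L (real^'n) \<Rightarrow>\<^sub>L real"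
    where g': "\<And>x. x \<in> U \<Longrightarrow> (g has_derivative blinfun_apply (g' x)) (at x)"
      and g'': "\<And>x. x \<in> U \<Longrightarrow> (g' has_derivative blinfun_apply (g'' x)) (at x)"
      and cont: "continuous_on U g''"
    using assms unfolding C2_on_def by blast
  define T :: "((real^'n) \<Rightarrow>\<^sub>L real) \<Rightarrow> real^'n"
    where "T \<phi> = (\<Sum>i\<in>UNIV. blinfun_apply \<phi> (axis i 1) *\<^sub>R axis i 1)" for \<phi>
  have T: "bounded_linear T"
    unfolding T_def by (intro bounded_linear_sum bounded_linear_scaleR_const blinfun.bounded_linear_left)
  have T_inner: "h \<bullet> T \<phi> = blinfun_apply \<phi> h" for h \<phi>
  proof -
    have "h \<bullet> T \<phi> = (\<Sum>i\<in>UNIV. h $ i * blinfun_apply \<phi> (axis i 1))"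
      by (simp add: T_def inner_sum_right inner_axis mult.commute)
    also have "\<dots> = blinfun_apply \<phi> (\<Sum>i\<in>UNIV. h $ i *\<^sub>R axis i 1)"
      by (simp add: blinfun.sum_right blinfun.scaleR_right)
    also have "(\<Sum>i\<in>UNIV. h $ i *\<^sub>R axis i 1) = h"
      using basis_expansion[of h] by (simp add: scalar_mult_eq_scaleR)
    finally show ?thesis .
  qed
  show thesis
  proof
    show "GDERIV g x :> T (g' x)" if "x \<in> U" for x
      using g'[OF that] by (simp add: gderiv_def T_inner)
    show "((\<lambda>x. T (g' x)) has_derivative blinfun_apply (Blinfun T o\<^sub>L g'' x)) (at x)" if "x \<in> U" for x
      using bounded_linear.has_derivative[OF T g''[OF that]]
      by (rule has_derivative_eq_rhs) (simp add: bounded_linear_Blinfun_apply[OF T] fun_eq_iff)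
    show "continuous_on U (\<lambda>x. Blinfun T o\<^sub>L g'' x)"
      by (intro continuous_intros cont)
  qed
qed

section \<open>Monotone and strongly monotone vector fields\<close>

text \<open>On the line through \<open>x\<close> in direction \<open>h\<close>, monotonicity makes
  \<open>t * (\<phi> t - \<phi> 0)\<close> nonnegative, which excludes a negative slope at 0. For
  the gradient field of the revenue this yields a positive semidefinite Hessian.\<close>

lemma has_derivative_monotone_nonneg:
  fixes G :: "'a::real_inner \<Rightarrow> 'a"
  assumes G: "(G has_derivative D) (at x)" and "open U" "x \<in> U"
    and mono: "\<And>y. y \<in> U \<Longrightarrow> 0 \<le> (G y - G x) \<bullet> (y - x)"
  shows "0 \<le> h \<bullet> D h"
proof -
  define \<phi> where "\<phi> t = h \<bullet> G (x + t *\<^sub>R h)" for t :: real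
  have "((\<lambda>t. x + t *\<^sub>R h) has_derivative (\<lambda>t. t *\<^sub>R h)) (at 0)"
    by (auto intro!: derivative_eq_intros)
  then have "((\<lambda>t. G (x + t *\<^sub>R h)) has_derivative (\<lambda>t. D (t *\<^sub>R h))) (at 0)"
    by (rule has_derivative_compose) (use G in simp)
  then have "(\<phi> has_derivative (\<lambda>t. h \<bullet> D (t *\<^sub>R h))) (at 0)"
    unfolding \<phi>_def by (rule has_derivative_inner_right)
  moreover have "D (t *\<^sub>R h) = t *\<^sub>R D h" for t
    using has_derivative_linear[OF G] by (simp add: linear_scale)
  ultimately have der: "(\<phi> has_real_derivative h \<bullet> D h) (at 0)"
    by (simp add: has_field_derivative_def mult_commute_abs)
  show ?thesis
  proof (rule ccontr)
    assume "\<not> 0 \<le> h \<bullet> D h"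
    then have "h \<bullet> D h < 0" by simp
    from DERIV_neg_dec_right[OF der this] obtain d
      where d: "d > 0" "\<And>t. 0 < t \<Longrightarrow> t < d \<Longrightarrow> \<phi> t < \<phi> 0"
      by auto
    have "((\<lambda>t. x + t *\<^sub>R h) \<longlongrightarrow> x + 0 *\<^sub>R h) (at_right 0)" by (intro tendsto_intros)
    then have "\<forall>\<^sub>F t in at_right 0. x + t *\<^sub>R h \<in> U"
      using assms by (auto dest!: topological_tendstoD)
    moreover have "\<forall>\<^sub>F t in at_right 0. 0 < t \<and> t < d"
      using d(1) eventually_at_right_less[of "0::real"] by (auto simp: eventually_at_right intro: exI[of _ d])
    ultimately have "\<forall>\<^sub>F t :: real in at_right 0. False"
    proof eventually_elim
      case (elim t)
      have "0 \<le> t * (\<phi> t - \<phi> 0)"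
        using mono[OF elim(1)] by (simp add: \<phi>_def inner_diff inner_commute right_diff_distrib)
      then show False using d(2)[of t] elim(2) by (simp add: zero_le_mult_iff)
    qed
    then show False by (simp add: trivial_limit_at_right_real)
  qed
qed

text \<open>The mean value theorem on the segment from \<open>x\<close> to \<open>y\<close> turns a
  bound on derivatives into a bound on increments. It is applied to the gradient of the mixed
  objective, also for signed supplies.\<close>

lemma coercive_derivative_imp_strongly_monotone:
  fixes G :: "'a::real_inner \<Rightarrow> 'a"
  assumes "convex B" "x \<in> B" "y \<in> B"
    and G: "\<And>z. z \<in> B \<Longrightarrow> (G has_derivative D z) (at z)"
    and coer: "\<And>z h. z \<in> B \<Longrightarrow> c * (h \<bullet> h) \<le> h \<bullet> D z h"
  shows "c * ((y - x) \<bullet> (y - x)) \<le> (G y - G x) \<bullet> (y - x)"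
proof -
  define h where "h = y - x"
  define \<phi> where "\<phi> t = h \<bullet> G (x + t *\<^sub>R h)" for t :: real
  have in_B: "x + t *\<^sub>R h \<in> B" if "0 \<le> t" "t \<le> 1" for t
    using convexD_alt[OF assms(1-3) that] by (simp add: h_def algebra_simps)
  have der: "(\<phi> has_real_derivative h \<bullet> D (x + t *\<^sub>R h) h) (at t)" if "0 \<le> t" "t \<le> 1" for t
  proof -
    note Gt = G[OF in_B[OF that]]
    have "((\<lambda>t. x + t *\<^sub>R h) has_derivative (\<lambda>t. t *\<^sub>R h)) (at t)"
      by (auto intro!: derivative_eq_intros)
    then have "((\<lambda>t. G (x + t *\<^sub>R h)) has_derivative (\<lambda>s. D (x + t *\<^sub>R h) (s *\<^sub>R h))) (at t)"
      by (rule has_derivative_compose) (use Gt in simp)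
    then have "(\<phi> has_derivative (\<lambda>s. h \<bullet> D (x + t *\<^sub>R h) (s *\<^sub>R h))) (at t)"
      unfolding \<phi>_def by (rule has_derivative_inner_right)
    moreover have "D (x + t *\<^sub>R h) (s *\<^sub>R h) = s *\<^sub>R D (x + t *\<^sub>R h) h" for s
      using has_derivative_linear[OF Gt] by (simp add: linear_scale)
    ultimately show ?thesis by (simp add: has_field_derivative_def mult_commute_abs)
  qed
  obtain t where "0 < t" "t < 1" "\<phi> 1 - \<phi> 0 = (1 - 0) * (h \<bullet> D (x + t *\<^sub>R h) h)"
    using MVT2[of 0 1 \<phi> "\<lambda>t. h \<bullet> D (x + t *\<^sub>R h) h"] der by force
  then have "c * (h \<bullet> h) \<le> \<phi> 1 - \<phi> 0" using coer in_B by simp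
  then show ?thesis by (simp add: \<phi>_def h_def inner_diff inner_commute)
qed

text \<open>
  Energy estimates: the stationarity equations are tested against the error itself, which lies in
  the space \<open>S\<close> of directions along which the curve is stationary.
\<close>

lemma stationary_curve_Lipschitz:
  fixes F \<Gamma> :: "'a::real_inner \<Rightarrow> 'a"
  assumes c: "0 < c"
    and mono: "c * ((y - x) \<bullet> (y - x)) \<le> ((F y + \<alpha>' *\<^sub>R \<Gamma> y) - (F x + \<alpha>' *\<^sub>R \<Gamma> x)) \<bullet> (y - x)"
    and x: "(F x + \<alpha> *\<^sub>R \<Gamma> x) \<bullet> (y - x) = 0" and y: "(F y + \<alpha>' *\<^sub>R \<Gamma> y) \<bullet> (y - x) = 0"
  shows "norm (y - x) \<le> norm (\<Gamma> x) / c * \<bar>\<alpha>' - \<alpha>\<bar>"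
proof (cases "y = x")
  case False
  \<comment> \<open>The two equations hold at different parameters; replacing
    \<open>\<alpha>'\<close> by \<open>\<alpha>\<close> at \<open>x\<close> leaves only the term
    with \<open>\<Gamma> x\<close>.\<close>
  have "c * (norm (y - x) * norm (y - x)) \<le> ((\<alpha> - \<alpha>') *\<^sub>R \<Gamma> x) \<bullet> (y - x)"
    using mono x y by (simp add: dot_square_norm power2_eq_square algebra_simps inner_add_left inner_diff_left)
  also have "\<dots> \<le> norm ((\<alpha> - \<alpha>') *\<^sub>R \<Gamma> x) * norm (y - x)" by (rule norm_cauchy_schwarz)
  finally have "c * norm (y - x) * norm (y - x) \<le> \<bar>\<alpha>' - \<alpha>\<bar> * norm (\<Gamma> x) * norm (y - x)"
    by (simp add: abs_minus_commute mult.assoc)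
  then have "c * norm (y - x) \<le> \<bar>\<alpha>' - \<alpha>\<bar> * norm (\<Gamma> x)" using False by simp
  then show ?thesis using c by (simp add: field_simps)
qed (use c in simp)

text \<open>The candidate \<open>V\<close> solves the linearised equation on \<open>S\<close>. The
  bound \<open>lip\<close> makes the Taylor remainder at \<open>\<beta> \<alpha>\<close> of smaller
  order than the parameter step, and coercivity converts this residual into a bound on the deviation
  from the linear prediction.\<close>

lemma stationary_curve_has_vector_derivative:
  fixes F \<Gamma> :: "'a::real_inner \<Rightarrow> 'a" and \<beta> :: "real \<Rightarrow> 'a"
  assumes c: "0 < c" and A: "open A" "\<alpha> \<in> A" and S: "subspace S"
    and F: "(F has_derivative DF) (at (\<beta> \<alpha>))"
    and \<Gamma>: "(\<Gamma> has_derivative D\<Gamma>) (at (\<beta> \<alpha>))"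
    and coer: "\<And>h. c * (h \<bullet> h) \<le> h \<bullet> (DF h + \<alpha> *\<^sub>R D\<Gamma> h)"
    and diff: "\<And>\<alpha>'. \<alpha>' \<in> A \<Longrightarrow> \<beta> \<alpha>' - \<beta> \<alpha> \<in> S"
    and stat: "\<And>\<alpha>' h. \<alpha>' \<in> A \<Longrightarrow> h \<in> S \<Longrightarrow> h \<bullet> (F (\<beta> \<alpha>') + \<alpha>' *\<^sub>R \<Gamma> (\<beta> \<alpha>')) = 0"
    and lip: "\<And>\<alpha>'. \<alpha>' \<in> A \<Longrightarrow> norm (\<beta> \<alpha>' - \<beta> \<alpha>) \<le> K * \<bar>\<alpha>' - \<alpha>\<bar>"
    and V: "V \<in> S" "\<And>h. h \<in> S \<Longrightarrow> h \<bullet> (DF V + \<alpha> *\<^sub>R D\<Gamma> V) = - (h \<bullet> \<Gamma> (\<beta> \<alpha>))"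
  shows "(\<beta> has_vector_derivative V) (at \<alpha>)"
proof -
  define E where "E x = F x + \<alpha> *\<^sub>R \<Gamma> x" for x
  define DE where "DE h = DF h + \<alpha> *\<^sub>R D\<Gamma> h" for h
  have E: "(E has_derivative DE) (at (\<beta> \<alpha>))"
    unfolding E_def[abs_def] DE_def[abs_def] using F \<Gamma> by (auto intro!: derivative_eq_intros)
  interpret DE: bounded_linear DE using E by (rule has_derivative_bounded_linear)
  have K: "0 \<le> K"
  proof -
    obtain d where "d > 0" "\<And>y. dist y \<alpha> < d \<Longrightarrow> y \<in> A"
      using A unfolding open_dist by blast
    then have "\<alpha> + d / 2 \<in> A" by (simp add: dist_real_def)
    then have "0 \<le> K * \<bar>d / 2\<bar>" using order_trans[OF norm_ge_zero lip[of "\<alpha> + d / 2"]] by simp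
    then show ?thesis using \<open>d > 0\<close> by (simp add: zero_le_mult_iff)
  qed
  have evA: "\<forall>\<^sub>F \<alpha>' in nhds \<alpha>. \<alpha>' \<in> A" using A by (simp add: eventually_nhds_in_open)
  have \<beta>lim: "(\<beta> \<longlongrightarrow> \<beta> \<alpha>) (nhds \<alpha>)"
  proof -
    have "((\<lambda>\<alpha>'. \<beta> \<alpha>' - \<beta> \<alpha>) \<longlongrightarrow> 0) (nhds \<alpha>)"
    proof (rule tendsto_0_le[where K = 1])
      have "((\<lambda>\<alpha>'. K * \<bar>\<alpha>' - \<alpha>\<bar>) \<longlongrightarrow> K * \<bar>\<alpha> - \<alpha>\<bar>) (nhds \<alpha>)"
        by (intro tendsto_intros filterlim_ident)
      then show "((\<lambda>\<alpha>'. K * \<bar>\<alpha>' - \<alpha>\<bar>) \<longlongrightarrow> 0) (nhds \<alpha>)" by simp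
      show "\<forall>\<^sub>F \<alpha>' in nhds \<alpha>. norm (\<beta> \<alpha>' - \<beta> \<alpha>) \<le> norm (K * \<bar>\<alpha>' - \<alpha>\<bar>) * 1"
        using evA by eventually_elim (use lip K in auto)
    qed
    then show ?thesis by (simp add: LIM_zero_iff)
  qed
  show ?thesis
    unfolding has_vector_derivative_def has_derivative_at_alt
  proof (intro conjI allI impI)
    show "bounded_linear (\<lambda>x. x *\<^sub>R V)" by (rule bounded_linear_scaleR_left)
    fix e :: real assume e: "0 < e"
    \<comment> \<open>The remainder is at most \<open>\<eta> * K\<close> times the step, hence half
      of the budget \<open>c * e\<close>; the other half pays for the change of
      \<open>\<Gamma>\<close>. Using \<open>K + 1\<close> avoids division by zero.\<close>
    define \<eta> where "\<eta> = c * e / (2 * (K + 1))"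
    have \<eta>: "0 < \<eta>" using c e K by (simp add: \<eta>_def)
    obtain d where d: "d > 0"
      "\<And>y. norm (y - \<beta> \<alpha>) < d \<Longrightarrow> norm (E y - E (\<beta> \<alpha>) - DE (y - \<beta> \<alpha>)) \<le> \<eta> * norm (y - \<beta> \<alpha>)"
      using E \<eta> unfolding has_derivative_at_alt by blast
    have "isCont \<Gamma> (\<beta> \<alpha>)" using \<Gamma> by (rule has_derivative_continuous)
    then have "((\<lambda>\<alpha>'. \<Gamma> (\<beta> \<alpha>')) \<longlongrightarrow> \<Gamma> (\<beta> \<alpha>)) (nhds \<alpha>)"
      using \<beta>lim by (rule isCont_tendsto_compose)
    then have "\<forall>\<^sub>F \<alpha>' in nhds \<alpha>. dist (\<Gamma> (\<beta> \<alpha>')) (\<Gamma> (\<beta> \<alpha>)) < c * e / 2"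
      by (rule tendstoD) (use c e in simp)
    moreover have "\<forall>\<^sub>F \<alpha>' in nhds \<alpha>. dist (\<beta> \<alpha>') (\<beta> \<alpha>) < d" using \<beta>lim d(1) by (rule tendstoD)
    ultimately have "\<forall>\<^sub>F \<alpha>' in nhds \<alpha>.
      norm (\<beta> \<alpha>' - \<beta> \<alpha> - (\<alpha>' - \<alpha>) *\<^sub>R V) \<le> e * norm (\<alpha>' - \<alpha>)"
      using evA
    proof eventually_elim
      case (elim \<alpha>')
      define w where "w = \<beta> \<alpha>' - \<beta> \<alpha>"
      \<comment> \<open>The error of the linear prediction. It lies in \<open>S\<close>, so the
        stationarity equations and the linearised equation can all be tested against it.\<close>
      define q where "q = w - (\<alpha>' - \<alpha>) *\<^sub>R V"
      define R where "R = E (\<beta> \<alpha>') - E (\<beta> \<alpha>) - DE w"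
      define G where "G = \<Gamma> (\<beta> \<alpha>') - \<Gamma> (\<beta> \<alpha>)"
      have qS: "q \<in> S" unfolding q_def w_def
        using S V(1) diff[OF elim(3)] by (simp add: subspace_diff subspace_scale)
      have R: "norm R \<le> \<eta> * norm w" using d(2) elim(2) by (simp add: R_def w_def dist_norm)
      have s1: "q \<bullet> E (\<beta> \<alpha>') = - (\<alpha>' - \<alpha>) * (q \<bullet> \<Gamma> (\<beta> \<alpha>'))"
        using stat[OF elim(3) qS] by (simp add: E_def inner_add_right algebra_simps)
      have s2: "q \<bullet> E (\<beta> \<alpha>) = 0" using stat[OF A(2) qS] by (simp add: E_def)
      have s3: "q \<bullet> DE V = - (q \<bullet> \<Gamma> (\<beta> \<alpha>))" using V(2)[OF qS] by (simp add: DE_def)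
      have "norm (- (\<alpha>' - \<alpha>) *\<^sub>R G - R) \<le> \<bar>\<alpha>' - \<alpha>\<bar> * norm G + norm R"
        using norm_triangle_ineq4[of "- (\<alpha>' - \<alpha>) *\<^sub>R G" R] by (simp add: abs_minus_commute)
      also have "\<dots> \<le> \<bar>\<alpha>' - \<alpha>\<bar> * (c * e / 2) + \<eta> * (K * \<bar>\<alpha>' - \<alpha>\<bar>)"
      proof (rule add_mono)
        show "\<bar>\<alpha>' - \<alpha>\<bar> * norm G \<le> \<bar>\<alpha>' - \<alpha>\<bar> * (c * e / 2)"
          using elim(1) by (intro mult_left_mono) (auto simp: G_def dist_norm)
        show "norm R \<le> \<eta> * (K * \<bar>\<alpha>' - \<alpha>\<bar>)"
          using order_trans[OF R mult_left_mono[OF lip[OF elim(3), folded w_def]]] \<eta> by simp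
      qed
      also have "\<dots> \<le> \<bar>\<alpha>' - \<alpha>\<bar> * (c * e)"
      proof -
        have "\<eta> * K \<le> \<eta> * (K + 1)" using \<eta> by simp
        also have "\<dots> = c * e / 2"
          unfolding \<eta>_def using K by (subst times_divide_eq_left, subst mult_divide_mult_cancel_right) auto
        finally have "\<bar>\<alpha>' - \<alpha>\<bar> * (\<eta> * K) \<le> \<bar>\<alpha>' - \<alpha>\<bar> * (c * e / 2)" by (rule mult_left_mono) simp
        then show ?thesis by (simp add: algebra_simps)
      qed
      finally have err: "norm (- (\<alpha>' - \<alpha>) *\<^sub>R G - R) \<le> \<bar>\<alpha>' - \<alpha>\<bar> * (c * e)" .
      have "c * (norm q * norm q) \<le> q \<bullet> DE q"
        using coer[of q] by (simp add: DE_def dot_square_norm power2_eq_square)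
      also have "DE q = DE w - (\<alpha>' - \<alpha>) *\<^sub>R DE V" by (simp add: q_def DE.diff DE.scaleR)
      also have "DE w = E (\<beta> \<alpha>') - E (\<beta> \<alpha>) - R" by (simp add: R_def)
      \<comment> \<open>By \<open>s1\<close>, \<open>s2\<close> and \<open>s3\<close> all terms of
        first order cancel; only the increment \<open>G\<close> and the remainder \<open>R\<close>
        survive.\<close>
      also have "q \<bullet> (E (\<beta> \<alpha>') - E (\<beta> \<alpha>) - R - (\<alpha>' - \<alpha>) *\<^sub>R DE V)
        = q \<bullet> (- (\<alpha>' - \<alpha>) *\<^sub>R G - R)"
        using s1 s2 s3 by (simp add: G_def inner_diff_right algebra_simps)
      also have "\<dots> \<le> norm q * norm (- (\<alpha>' - \<alpha>) *\<^sub>R G - R)" by (rule norm_cauchy_schwarz)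
      also have "\<dots> \<le> norm q * (\<bar>\<alpha>' - \<alpha>\<bar> * (c * e))" using err by (rule mult_left_mono) simp
      finally have "norm q * (c * norm q) \<le> norm q * (c * (e * \<bar>\<alpha>' - \<alpha>\<bar>))"
        by (simp add: mult_ac)
      then have "norm q \<le> e * \<bar>\<alpha>' - \<alpha>\<bar>"
        using c e by (cases "norm q = 0") auto
      then show ?case by (simp add: q_def w_def)
    qed
    then show "\<exists>d>0. \<forall>y. norm (y - \<alpha>) < d \<longrightarrow>
       norm (\<beta> y - \<beta> \<alpha> - (y - \<alpha>) *\<^sub>R V) \<le> e * norm (y - \<alpha>)"
      unfolding eventually_nhds_metric by (simp add: dist_norm)
  qed
qed

text \<open>A pseudoinverse need not depend continuously on its matrix. Here the test space
  \<open>S\<close> is fixed and the coercivity uniform, so testing the equation at \<alpha> with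
  \<open>V \<alpha> - V 0\<close> bounds this difference by a residual.\<close>

lemma coercive_solution_tendsto:
  fixes H :: "real \<Rightarrow> 'a::real_inner \<Rightarrow>\<^sub>L 'a" and V \<delta> :: "real \<Rightarrow> 'a"
  assumes c: "0 < c" and S: "subspace S"
    and coer: "\<forall>\<^sub>F \<alpha> in nhds 0. \<forall>h. c * (h \<bullet> h) \<le> h \<bullet> H \<alpha> h"
    and V: "\<forall>\<^sub>F \<alpha> in nhds 0. V \<alpha> \<in> S \<and> (\<forall>h\<in>S. h \<bullet> H \<alpha> (V \<alpha>) = h \<bullet> \<delta> \<alpha>)"
    and H: "(H \<longlongrightarrow> H 0) (nhds 0)" and \<delta>: "(\<delta> \<longlongrightarrow> \<delta> 0) (nhds 0)"
  shows "(V \<longlongrightarrow> V 0) (nhds 0)"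
proof -
  \<comment> \<open>Tested against \<open>S\<close>, this is the residual left by \<open>V 0\<close>
    in the equation at \<alpha>, rewritten with the equation at 0.\<close>
  define r where "r \<alpha> = \<delta> \<alpha> - \<delta> 0 + (H 0 - H \<alpha>) (V 0)" for \<alpha>
  have V0: "V 0 \<in> S" "\<And>h. h \<in> S \<Longrightarrow> h \<bullet> H 0 (V 0) = h \<bullet> \<delta> 0"
    using eventually_nhds_x_imp_x[OF V] by auto
  have "((\<lambda>\<alpha>. V \<alpha> - V 0) \<longlongrightarrow> 0) (nhds 0)"
  proof (rule tendsto_0_le[where K = "1 / c"])
    have "(r \<longlongrightarrow> \<delta> 0 - \<delta> 0 + (H 0 - H 0) (V 0)) (nhds 0)"
      unfolding r_def[abs_def] by (intro tendsto_intros H \<delta>)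
    then show "(r \<longlongrightarrow> 0) (nhds 0)" by simp
    show "\<forall>\<^sub>F \<alpha> in nhds 0. norm (V \<alpha> - V 0) \<le> norm (r \<alpha>) * (1 / c)"
      using coer V
    proof eventually_elim
      case (elim \<alpha>)
      define q where "q = V \<alpha> - V 0"
      have q: "q \<in> S" using S elim V0 by (simp add: q_def subspace_diff)
      have "c * (norm q * norm q) \<le> q \<bullet> H \<alpha> q"
        using elim by (simp add: dot_square_norm power2_eq_square[of "norm q", symmetric])
      also have "\<dots> = q \<bullet> r \<alpha>"
      proof -
        have "q \<bullet> H \<alpha> q = q \<bullet> H \<alpha> (V \<alpha>) - q \<bullet> H \<alpha> (V 0)"
          by (simp add: q_def blinfun.diff_right inner_diff_right)
        then show ?thesis using elim q V0(2)[OF q]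
          by (simp add: r_def blinfun.diff_left inner_diff_right inner_add_right)
      qed
      also have "\<dots> \<le> norm q * norm (r \<alpha>)" by (rule norm_cauchy_schwarz)
      finally have "norm q * (c * norm q) \<le> norm q * norm (r \<alpha>)" by (simp add: mult_ac)
      then have "c * norm q \<le> norm (r \<alpha>)" by (cases "norm q = 0") auto
      then show ?case using c by (simp add: q_def field_simps)
    qed
  qed
  then show ?thesis by (simp add: LIM_zero_iff)
qed

section \<open>Moore-Penrose inverse of a compressed matrix\<close>

text \<open>\<open>A Y A X = A X\<close> and \<open>A X A Y = A Y\<close> by absorption, and the two
  left sides are transposes of each other, so \<open>A X = A Y\<close>; likewise
  \<open>X A = Y A\<close>.\<close>

lemma is_moore_penrose_unique:
  assumes "is_moore_penrose A X" "is_moore_penrose A Y"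
  shows "X = Y"
proof -
  note a = assms[unfolded is_moore_penrose_def]
  have AXY: "A ** X = A ** Y"
  proof -
    have "A ** X = transpose (A ** Y ** (A ** X))"
      using a by (simp add: matrix_mul_assoc)
    also have "\<dots> = A ** X ** (A ** Y)"
      using a by (simp add: matrix_transpose_mul)
    also have "\<dots> = A ** Y" using a by (simp add: matrix_mul_assoc)
    finally show ?thesis .
  qed
  have XYA: "X ** A = Y ** A"
  proof -
    have "X ** A = transpose ((X ** A) ** (Y ** A))"
      using a by (metis matrix_mul_assoc)
    also have "\<dots> = (Y ** A) ** (X ** A)"
      using a by (simp add: matrix_transpose_mul)
    also have "\<dots> = Y ** A" using a by (metis matrix_mul_assoc)
    finally show ?thesis .
  qed
  have "X = X ** A ** X" using a by simp
  also have "\<dots> = Y ** (A ** X)" by (simp add: XYA matrix_mul_assoc)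
  also have "\<dots> = Y ** A ** Y" by (simp add: AXY matrix_mul_assoc)
  finally show ?thesis using a by simp
qed

text \<open>The compression is invertible on the range of \<open>P\<close> and zero on its
  complement. Symmetry of \<open>H\<close> is not assumed: both \<open>A X\<close> and
  \<open>X A\<close> equal the symmetric matrix \<open>P\<close>. The conclusions say that the
  pseudoinverse maps into the range of \<open>P\<close> and solves the compressed equation
  there.\<close>

lemma pinv_compression:
  fixes H P :: "real^'n^'n"
  assumes P: "P ** P = P" "transpose P = P"
    and pos: "\<And>h. h \<noteq> 0 \<Longrightarrow> 0 < h \<bullet> (H *v h)"
  shows "P ** pinv (P ** H ** P) = pinv (P ** H ** P)"
    and "P ** H ** pinv (P ** H ** P) = P"
proof -
  define A where "A = P ** H ** P"
  \<comment> \<open>Adding the identity on the complement restores invertibility, because the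
    quadratic form of \<open>B\<close> splits orthogonally along \<open>P\<close>.\<close>
  define B where "B = A + (mat 1 - P)"
  have PA: "P ** A = A" unfolding A_def by (simp add: matrix_mul_assoc P)
  have AP: "A ** P = A" unfolding A_def by (metis matrix_mul_assoc P(1))
  have inner_P: "x \<bullet> (P *v y) = (P *v x) \<bullet> y" for x y
    by (metis P(2) dot_lmul_matrix transpose_matrix_vector)
  have PP: "P *v (P *v x) = P *v x" for x by (simp add: matrix_vector_mul_assoc P)
  have PAv: "P *v (A *v x) = A *v x" and APv: "A *v (P *v x) = A *v x" for x
    by (simp_all add: matrix_vector_mul_assoc PA AP)
  have "x = 0" if "B *v x = 0" for x
  proof -
    define y where "y = P *v x"
    have "x \<bullet> (B *v x) = y \<bullet> (H *v y) + (x - y) \<bullet> (x - y)"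
    proof -
      have "B *v x = P *v (H *v y) + (x - y)"
        by (simp add: B_def A_def y_def matrix_vector_mult_add_rdistrib
            matrix_vector_mult_diff_rdistrib matrix_vector_mul_assoc matrix_mul_assoc)
      moreover have "x \<bullet> (x - y) = (x - y) \<bullet> (x - y)"
        using inner_P[of y x] inner_P[of x y] by (simp add: y_def PP inner_diff inner_commute)
      ultimately show ?thesis using inner_P[of x "H *v y"] by (simp add: inner_add_right y_def)
    qed
    then have "y \<bullet> (H *v y) + (x - y) \<bullet> (x - y) = 0" using that by simp
    moreover have "0 \<le> y \<bullet> (H *v y)" using pos[of y] by (cases "y = 0") auto
    ultimately have "y \<bullet> (H *v y) = 0" "(x - y) \<bullet> (x - y) = 0"
      by (smt (verit) inner_ge_zero)+
    then have "y = 0" "x = y" using pos[of y] by force+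
    then show ?thesis by simp
  qed
  then obtain C where CB: "C ** B = mat 1"
    using matrix_left_invertible_ker[of B] by auto
  then have BC: "B ** C = mat 1" by (simp add: matrix_left_right_inverse)
  have PB: "P ** B = A" "B ** P = A"
    by (simp_all add: matrix_eq B_def matrix_vector_mul_assoc[symmetric] PP PAv APv matrix_vector_right_distrib
        matrix_vector_mult_diff_distrib matrix_vector_mult_add_rdistrib matrix_vector_mult_diff_rdistrib)
  \<comment> \<open>The inverse of \<open>B\<close> acts as the identity on the complement, so
    multiplying by \<open>P\<close> isolates the part that belongs to \<open>A\<close>.\<close>
  define X where "X = C ** P"
  have XP: "X = P ** C"
    by (metis BC CB PB X_def matrix_mul_assoc matrix_mul_lid matrix_mul_rid)
  have AX: "A ** X = P" by (metis BC PB(1) P(1) XP X_def matrix_mul_assoc matrix_mul_rid PB(2))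
  have XA: "X ** A = P" by (metis CB PB(2) P(1) X_def matrix_mul_assoc matrix_mul_lid PB(1) XP)
  have PX: "P ** X = X" by (simp add: XP matrix_mul_assoc P)
  have "is_moore_penrose A X"
    unfolding is_moore_penrose_def using AX XA PA PX P(2) by simp
  then have "pinv A = X"
    unfolding pinv_def by (rule the_equality) (use \<open>is_moore_penrose A X\<close> is_moore_penrose_unique in blast)
  then show "P ** pinv (P ** H ** P) = pinv (P ** H ** P)" "P ** H ** pinv (P ** H ** P) = P"
    using PX AX unfolding A_def by (simp, metis PX matrix_mul_assoc)
qed

section \<open>Winning bids\<close>

text \<open>The type of buyers carries no order, so \<open>to_nat\<close> supplies one;
  \<open>Suc\<close> reserves rank 0 for the favoured buyer.\<close>

definition priority :: "'n::finite \<Rightarrow> 'n \<Rightarrow> nat" where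
  "priority k i = (if i = k then 0 else Suc (to_nat i))"

text \<open>Ties are broken in favour of buyer \<open>k\<close>, and otherwise by an arbitrary fixed order.\<close>

definition wins :: "('n::finite \<Rightarrow> 't \<Rightarrow> real) \<Rightarrow> 'n \<Rightarrow> real^'n \<Rightarrow> 't \<Rightarrow> 'n \<Rightarrow> bool" where
  "wins v k \<beta> \<theta> i \<longleftrightarrow>
     (\<forall>j. \<beta> $ j * v j \<theta> < \<beta> $ i * v i \<theta> \<or>
          \<beta> $ j * v j \<theta> = \<beta> $ i * v i \<theta> \<and> priority k i \<le> priority k j)"

text \<open>A subgradient of \<open>max_bid v \<theta>\<close> at \<open>\<beta>\<close>. The
  favoured buyer \<open>k\<close> stays a parameter so that two ways of breaking the same tie can be
  compared.\<close>

definition winning_value :: "('n::finite \<Rightarrow> 't \<Rightarrow> real) \<Rightarrow> 'n \<Rightarrow> real^'n \<Rightarrow> 't \<Rightarrow> real^'n" where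
  "winning_value v k \<beta> \<theta> = (\<chi> i. of_bool (wins v k \<beta> \<theta> i) * v i \<theta>)"

text \<open>For positive multipliers and nonnegative valuations these are exactly the items where
  \<open>max_bid v \<theta>\<close> is not differentiable. The condition
  \<open>0 < v i \<theta>\<close> leaves out items worthless to everybody: there all bids agree, but
  the maximum is identically zero.\<close>

definition tied :: "('n::finite \<Rightarrow> 't \<Rightarrow> real) \<Rightarrow> real^'n \<Rightarrow> 't \<Rightarrow> bool" where
  "tied v \<beta> \<theta> \<longleftrightarrow> (\<exists>i j. i \<noteq> j \<and> \<beta> $ i * v i \<theta> = max_bid v \<theta> \<beta> \<and>
     \<beta> $ j * v j \<theta> = max_bid v \<theta> \<beta> \<and> 0 < v i \<theta>)"

lemma priority_inj: "priority k i = priority k j \<longleftrightarrow> i = j"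
  by (auto simp: priority_def)

lemma wins_imp_max_bid: "wins v k \<beta> \<theta> i \<Longrightarrow> \<beta> $ i * v i \<theta> = max_bid v \<theta> \<beta>"
  unfolding max_bid_def wins_def by (rule Max_eqI[symmetric]) (auto intro: less_imp_le)

lemma max_bid_attained: obtains i where "max_bid v \<theta> \<beta> = \<beta> $ i * v i \<theta>"
proof -
  have "max_bid v \<theta> \<beta> \<in> range (\<lambda>i. \<beta> $ i * v i \<theta>)"
    unfolding max_bid_def by (rule Max_in) auto
  then show thesis using that by auto
qed

lemma wins_ex1: "\<exists>!i. wins v k \<beta> \<theta> i"
proof -
  define A where "A = {i. \<beta> $ i * v i \<theta> = max_bid v \<theta> \<beta>}"
  have A: "finite A" "A \<noteq> {}"
    unfolding A_def using max_bid_attained[of v \<theta> \<beta>] by (simp, metis (mono_tags) empty_iff mem_Collect_eq)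
  define i where "i = arg_min_on (priority k) A"
  have "i \<in> A" "\<And>j. j \<in> A \<Longrightarrow> priority k i \<le> priority k j"
    unfolding i_def using A by (auto intro: arg_min_if_finite arg_min_least)
  then have "wins v k \<beta> \<theta> i"
    unfolding wins_def A_def using max_bid_ge[of \<beta> _ v \<theta>] by (auto simp: order_le_less)
  moreover have "j = i" if "wins v k \<beta> \<theta> j" "wins v k \<beta> \<theta> i" for j
    using that unfolding wins_def by (metis order.asym order_antisym priority_inj order_less_irrefl)
  ultimately show ?thesis by blast
qed

lemma sum_wins:
  fixes f :: "'n::finite \<Rightarrow> real"
  assumes "wins v k \<beta> \<theta> i"
  shows "(\<Sum>j\<in>UNIV. of_bool (wins v k \<beta> \<theta> j) * f j) = f i"
proof -
  have "wins v k \<beta> \<theta> j \<longleftrightarrow> j = i" for j using assms wins_ex1[of v k \<beta> \<theta>] by auto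
  then show ?thesis by (simp add: of_bool_def if_distribR if_distrib[of "\<lambda>x. x * _"] cong: if_cong)
qed

lemma winning_value_inner:
  assumes "wins v k \<beta> \<theta> i"
  shows "winning_value v k \<beta> \<theta> \<bullet> h = v i \<theta> * h $ i"
  using sum_wins[OF assms, of "\<lambda>j. v j \<theta> * h $ j"]
  by (simp add: winning_value_def inner_vec_def mult.assoc)

lemma max_bid_subgradient:
  "max_bid v \<theta> \<beta> + winning_value v k \<beta> \<theta> \<bullet> (\<gamma> - \<beta>) \<le> max_bid v \<theta> \<gamma>"
proof -
  obtain i where i: "wins v k \<beta> \<theta> i" using wins_ex1[of v k \<beta> \<theta>] by auto
  have "max_bid v \<theta> \<beta> + winning_value v k \<beta> \<theta> \<bullet> (\<gamma> - \<beta>) = \<gamma> $ i * v i \<theta>"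
    using wins_imp_max_bid[OF i] by (simp add: winning_value_inner[OF i] algebra_simps)
  then show ?thesis using max_bid_ge[of \<gamma> i v \<theta>] by simp
qed

lemma measurable_wins:
  assumes [measurable]: "\<And>i. v i \<in> borel_measurable M"
  shows "Measurable.pred M (\<lambda>\<theta>. wins v k \<beta> \<theta> i)"
  unfolding wins_def by measurable

lemma wins_favoured: "wins v k \<beta> \<theta> k \<longleftrightarrow> \<beta> $ k * v k \<theta> = max_bid v \<theta> \<beta>"
proof
  assume "\<beta> $ k * v k \<theta> = max_bid v \<theta> \<beta>"
  then show "wins v k \<beta> \<theta> k"
    unfolding wins_def using max_bid_ge[of \<beta> _ v \<theta>] by (auto simp: order_le_less priority_def)
qed (rule wins_imp_max_bid)

text \<open>Without a tie one bid stays maximal in a whole neighbourhood, so the maximum is locally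
  linear.\<close>

lemma max_bid_has_gradient:
  fixes v :: "'n::finite \<Rightarrow> 't \<Rightarrow> real"
  assumes v: "\<And>i. 0 \<le> v i \<theta>" and \<beta>: "\<And>i. 0 < \<beta> $ i" and "\<not> tied v \<beta> \<theta>"
  shows "GDERIV (max_bid v \<theta>) \<beta> :> winning_value v k \<beta> \<theta>"
proof -
  obtain i where i: "wins v k \<beta> \<theta> i" using wins_ex1[of v k \<beta> \<theta>] by auto
  have max: "max_bid v \<theta> \<beta> = \<beta> $ i * v i \<theta>" using wins_imp_max_bid[OF i] by simp
  have ev: "\<forall>\<^sub>F \<gamma> in nhds \<beta>. \<gamma> $ i * v i \<theta> = max_bid v \<theta> \<gamma>"
  proof (cases "v i \<theta> = 0")
    case True
    have "v j \<theta> = 0" for j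
      using max_bid_ge[of \<beta> j v \<theta>] max True v[of j] \<beta>[of j]
      by (metis mult_eq_0_iff mult_nonneg_nonneg mult_zero_right order_antisym less_imp_le less_irrefl)
    then show ?thesis by (simp add: max_bid_def)
  next
    case False
    then have "0 < v i \<theta>" using v[of i] by simp
    then have less: "\<beta> $ j * v j \<theta> < \<beta> $ i * v i \<theta>" if "j \<noteq> i" for j
      using that \<open>\<not> tied v \<beta> \<theta>\<close> max max_bid_ge[of \<beta> j v \<theta>] unfolding tied_def
      by (metis order_le_less)
    have "\<forall>\<^sub>F \<gamma> in nhds \<beta>. \<gamma> $ j * v j \<theta> \<le> \<gamma> $ i * v i \<theta>" for j
    proof (cases "j = i")
      case False
      have "((\<lambda>\<gamma>. \<gamma> $ i * v i \<theta> - \<gamma> $ j * v j \<theta>) \<longlongrightarrow> \<beta> $ i * v i \<theta> - \<beta> $ j * v j \<theta>) (nhds \<beta>)"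
        by (intro tendsto_intros filterlim_ident)
      then have "\<forall>\<^sub>F \<gamma> in nhds \<beta>. 0 < \<gamma> $ i * v i \<theta> - \<gamma> $ j * v j \<theta>"
        by (rule order_tendstoD) (use less[OF False] in simp)
      then show ?thesis by eventually_elim simp
    qed simp
    then have "\<forall>\<^sub>F \<gamma> in nhds \<beta>. \<forall>j. \<gamma> $ j * v j \<theta> \<le> \<gamma> $ i * v i \<theta>"
      by (simp add: eventually_all_finite)
    then show ?thesis
      by eventually_elim (auto simp: max_bid_def intro!: Max_eqI[symmetric])
  qed
  have "((\<lambda>\<gamma>. \<gamma> $ i * v i \<theta>) has_derivative (\<lambda>h. h \<bullet> winning_value v k \<beta> \<theta>)) (at \<beta>)"
    unfolding inner_commute[of _ "winning_value v k \<beta> \<theta>"] winning_value_inner[OF i]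
    by (auto intro!: derivative_eq_intros bounded_linear_imp_has_derivative bounded_linear_vec_nth)
  moreover have "\<forall>\<^sub>F \<gamma> in at \<beta>. \<gamma> $ i * v i \<theta> = max_bid v \<theta> \<gamma>"
    using ev by (simp add: eventually_at_filter eventually_mono)
  ultimately show ?thesis
    unfolding gderiv_def by (rule has_derivative_transform_eventually) (use max in simp_all)
qed

text \<open>Favouring \<open>i\<close> or \<open>j\<close> gives subgradients with different
  \<open>i\<close>-th coordinates, while a gradient would have to equal both. This fixes what
  \<open>grad\<close> denotes at ties, which the measurability of the integrand in
  \<open>supply_shift\<close> depends on.\<close>

lemma tied_imp_no_gradient:
  assumes "tied v \<beta> \<theta>"
  shows "\<not> GDERIV (max_bid v \<theta>) \<beta> :> D"
proof
  assume D: "GDERIV (max_bid v \<theta>) \<beta> :> D"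
  obtain i j where ij: "i \<noteq> j" "\<beta> $ i * v i \<theta> = max_bid v \<theta> \<beta>" "\<beta> $ j * v j \<theta> = max_bid v \<theta> \<beta>"
    "0 < v i \<theta>" using assms unfolding tied_def by blast
  have "D = winning_value v k \<beta> \<theta>" for k
    using D max_bid_subgradient by (rule gderiv_eq_subgradient)
  moreover have "winning_value v i \<beta> \<theta> $ i = v i \<theta>"
    using ij(2) by (simp add: winning_value_def wins_favoured)
  moreover have "winning_value v j \<beta> \<theta> $ i = 0"
    using ij(1,3) wins_ex1[of v j \<beta> \<theta>] wins_favoured[of v j \<beta> \<theta>]
    by (auto simp: winning_value_def)
  ultimately show False using ij(4) by force
qed

lemma gderiv_unique:
  assumes "GDERIV g x :> D" "GDERIV g x :> E"
  shows "D = E"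
proof -
  have "(\<lambda>h. h \<bullet> D) = (\<lambda>h. h \<bullet> E)"
    using assms unfolding gderiv_def by (rule has_derivative_unique)
  then show ?thesis by (metis inner_commute vector_eq_rdot)
qed

lemma grad_eq: "GDERIV g x :> D \<Longrightarrow> grad g x = D"
  unfolding grad_def by (rule the_equality) (auto intro: gderiv_unique)

section \<open>Revenue, its subgradients and its gradient\<close>

definition revenue :: "'t measure \<Rightarrow> ('n::finite \<Rightarrow> 't \<Rightarrow> real) \<Rightarrow> ('t \<Rightarrow> real) \<Rightarrow> real^'n \<Rightarrow> real" where
  "revenue M v r \<beta> = (\<integral>\<theta>. max_bid v \<theta> \<beta> * r \<theta> \<partial>M)"

text \<open>Multiplied by \<open>\<beta> $ i\<close>, coordinate \<open>i\<close> is the spend of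
  buyer \<open>i\<close> when ties are broken in favour of \<open>k\<close>; this links derivatives
  to budgets.\<close>

definition revenue_subgradient ::
  "'t measure \<Rightarrow> ('n::finite \<Rightarrow> 't \<Rightarrow> real) \<Rightarrow> ('t \<Rightarrow> real) \<Rightarrow> 'n \<Rightarrow> real^'n \<Rightarrow> real^'n" where
  "revenue_subgradient M v r k \<beta> = (\<chi> i. \<integral>\<theta>. winning_value v k \<beta> \<theta> $ i * r \<theta> \<partial>M)"

locale bidders =
  fixes M :: "'t measure" and v :: "'n::finite \<Rightarrow> 't \<Rightarrow> real"
  assumes v_nonneg: "\<theta> \<in> space M \<Longrightarrow> 0 \<le> v i \<theta>"
    and v_integrable: "integrable M (v i)"
begin

lemma v_measurable [measurable]: "v i \<in> borel_measurable M"
  using v_integrable by blast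

lemma winning_value_measurable [measurable]: "(\<lambda>\<theta>. winning_value v k \<beta> \<theta> $ i) \<in> borel_measurable M"
proof -
  note measurable_wins[measurable]
  show ?thesis unfolding winning_value_def by simp
qed

lemma integrable_winning_value:
  assumes "Linf_plus M r"
  shows "integrable M (\<lambda>\<theta>. winning_value v k \<beta> \<theta> $ i * r \<theta>)"
proof (rule integrable_mult_Linf_plus[OF _ assms])
  show "integrable M (\<lambda>\<theta>. winning_value v k \<beta> \<theta> $ i)"
    by (rule Bochner_Integration.integrable_bound[OF v_integrable[of i] winning_value_measurable])
      (simp add: winning_value_def)
qed

lemma integrable_revenue:
  assumes "Linf_plus M r"
  shows "integrable M (\<lambda>\<theta>. max_bid v \<theta> \<beta> * r \<theta>)"
  using assms by (intro integrable_mult_Linf_plus integrable_max_bid v_integrable)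

text \<open>The pointwise inequality survives integration because the supply is nonnegative.
  Convexity is therefore drawn from \<open>s\<close> and \<open>s'\<close> separately, never from a
  signed mixture.\<close>

lemma revenue_ge_subgradient:
  assumes r: "Linf_plus M r"
  shows "revenue M v r \<beta> + revenue_subgradient M v r k \<beta> \<bullet> (\<gamma> - \<beta>) \<le> revenue M v r \<gamma>"
proof -
  have int: "integrable M (\<lambda>\<theta>. winning_value v k \<beta> \<theta> $ i * r \<theta> * h)" for i h
    using integrable_winning_value[OF r] by simp
  have "revenue_subgradient M v r k \<beta> \<bullet> (\<gamma> - \<beta>)
      = (\<integral>\<theta>. (\<Sum>i\<in>UNIV. winning_value v k \<beta> \<theta> $ i * r \<theta> * (\<gamma> - \<beta>) $ i) \<partial>M)"
    using int by (subst Bochner_Integration.integral_sum) (auto simp: inner_vec_def revenue_subgradient_def)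
  then have "revenue M v r \<beta> + revenue_subgradient M v r k \<beta> \<bullet> (\<gamma> - \<beta>)
      = (\<integral>\<theta>. max_bid v \<theta> \<beta> * r \<theta> + (\<Sum>i\<in>UNIV. winning_value v k \<beta> \<theta> $ i * r \<theta> * (\<gamma> - \<beta>) $ i) \<partial>M)"
    unfolding revenue_def
    by (subst Bochner_Integration.integral_add)
      (simp, intro integrable_revenue r, intro Bochner_Integration.integrable_sum int, simp)
  also have "\<dots> \<le> revenue M v r \<gamma>"
    unfolding revenue_def
  proof (rule integral_mono_AE)
    show "integrable M (\<lambda>\<theta>. max_bid v \<theta> \<beta> * r \<theta> +
        (\<Sum>i\<in>UNIV. winning_value v k \<beta> \<theta> $ i * r \<theta> * (\<gamma> - \<beta>) $ i))"
      by (intro Bochner_Integration.integrable_add Bochner_Integration.integrable_sum int integrable_revenue r)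
    show "integrable M (\<lambda>\<theta>. max_bid v \<theta> \<gamma> * r \<theta>)" by (rule integrable_revenue[OF r])
    have "AE \<theta> in M. 0 \<le> r \<theta>" using r unfolding Linf_plus_def by auto
    then show "AE \<theta> in M. max_bid v \<theta> \<beta> * r \<theta> +
        (\<Sum>i\<in>UNIV. winning_value v k \<beta> \<theta> $ i * r \<theta> * (\<gamma> - \<beta>) $ i) \<le> max_bid v \<theta> \<gamma> * r \<theta>"
    proof eventually_elim
      case (elim \<theta>)
      have "(\<Sum>i\<in>UNIV. winning_value v k \<beta> \<theta> $ i * r \<theta> * (\<gamma> - \<beta>) $ i)
          = (winning_value v k \<beta> \<theta> \<bullet> (\<gamma> - \<beta>)) * r \<theta>"
        by (simp add: inner_vec_def sum_distrib_left mult_ac)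
      then show ?case
        using mult_right_mono[OF max_bid_subgradient[of v \<theta> \<beta> k \<gamma>] elim] by (simp add: distrib_right)
    qed
  qed
  finally show ?thesis .
qed

lemma revenue_gradient:
  assumes "Linf_plus M r" "GDERIV (revenue M v r) \<beta> :> D"
  shows "revenue_subgradient M v r k \<beta> = D"
  using gderiv_eq_subgradient[OF assms(2) revenue_ge_subgradient[OF assms(1)]] by simp

lemma revenue_gradient_monotone:
  assumes "Linf_plus M r" "GDERIV (revenue M v r) x :> D" "GDERIV (revenue M v r) y :> E"
  shows "0 \<le> (E - D) \<bullet> (y - x)"
proof -
  obtain k :: 'n where True by simp
  have "revenue M v r x + D \<bullet> (y - x) \<le> revenue M v r y"
    using revenue_ge_subgradient[OF assms(1), of x k y] revenue_gradient[OF assms(1,2)] by simp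
  moreover have "revenue M v r y + E \<bullet> (x - y) \<le> revenue M v r x"
    using revenue_ge_subgradient[OF assms(1), of y k x] revenue_gradient[OF assms(1,3)] by simp
  ultimately show ?thesis by (simp add: inner_diff algebra_simps)
qed

lemma convex_revenue:
  assumes r: "Linf_plus M r"
  shows "convex_on UNIV (revenue M v r)"
proof (rule convex_onI)
  fix t :: real and x y :: "real^'n"
  assume t: "0 < t" "t < 1"
  obtain k :: 'n where True by simp
  define z where "z = (1 - t) *\<^sub>R x + t *\<^sub>R y"
  define g where "g = revenue_subgradient M v r k z"
  have "(1 - t) * (revenue M v r z + g \<bullet> (x - z)) + t * (revenue M v r z + g \<bullet> (y - z))
      \<le> (1 - t) * revenue M v r x + t * revenue M v r y"
    unfolding g_def using t by (intro add_mono mult_left_mono revenue_ge_subgradient r) auto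
  moreover have "(1 - t) * (revenue M v r z + g \<bullet> (x - z)) + t * (revenue M v r z + g \<bullet> (y - z))
      = revenue M v r z + g \<bullet> ((1 - t) *\<^sub>R (x - z) + t *\<^sub>R (y - z))"
    by (simp add: inner_add_right algebra_simps)
  moreover have "(1 - t) *\<^sub>R (x - z) + t *\<^sub>R (y - z) = 0"
    by (simp add: z_def algebra_simps)
  ultimately show "revenue M v r ((1 - t) *\<^sub>R x + t *\<^sub>R y)
      \<le> (1 - t) * revenue M v r x + t * revenue M v r y"
    by (simp add: z_def)
qed simp

lemma continuous_on_revenue: "Linf_plus M r \<Longrightarrow> continuous_on UNIV (revenue M v r)"
  using convex_revenue by (intro convex_on_continuous) auto

text \<open>
  Breaking ties in favour of \<open>i\<close> or of \<open>j\<close> yields two subgradients of the revenue; at a point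
  of differentiability they agree, so that tied items carry no supply.
\<close>

lemma tied_AE_no_supply:
  assumes r: "Linf_plus M r" and D: "GDERIV (revenue M v r) \<beta> :> D"
  shows "AE \<theta> in M. tied v \<beta> \<theta> \<longrightarrow> r \<theta> = 0"
proof -
  have rnn: "AE \<theta> in M. 0 \<le> r \<theta>" using r unfolding Linf_plus_def by auto
  \<comment> \<open>The drop in coordinate \<open>i\<close> of the subgradient when favour passes
    from \<open>i\<close> to \<open>j\<close>. It is nonnegative with zero integral, so it vanishes
    almost everywhere.\<close>
  define gain where
    "gain i j \<theta> = winning_value v i \<beta> \<theta> $ i * r \<theta> - winning_value v j \<beta> \<theta> $ i * r \<theta>" for i j \<theta>
  have "AE \<theta> in M. gain i j \<theta> = 0" for i j
  proof (rule integral_nonneg_eq_0_iff_AE[THEN iffD1])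
    show "integrable M (gain i j)"
      unfolding gain_def[abs_def] using integrable_winning_value[OF r] by simp
    have "winning_value v j \<beta> \<theta> $ i \<le> winning_value v i \<beta> \<theta> $ i" if "\<theta> \<in> space M" for \<theta>
      using v_nonneg[OF that, of i] wins_favoured[of v i \<beta> \<theta>] wins_imp_max_bid[of v j \<beta> \<theta> i]
      by (auto simp: winning_value_def)
    then show "AE \<theta> in M. 0 \<le> gain i j \<theta>"
      using rnn AE_space[of M] by (auto simp: gain_def intro: mult_right_mono elim!: eventually_elim2)
    show "integral\<^sup>L M (gain i j) = 0"
      unfolding gain_def[abs_def]
      using integrable_winning_value[OF r] revenue_gradient[OF r D, of i] revenue_gradient[OF r D, of j]
      by (simp add: revenue_subgradient_def vec_eq_iff)
  qed
  then have "AE \<theta> in M. \<forall>i j. gain i j \<theta> = 0" by (simp add: AE_all_countable)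
  then show ?thesis
  proof eventually_elim
    case (elim \<theta>)
    show ?case
    proof
      assume "tied v \<beta> \<theta>"
      then obtain i j where ij: "i \<noteq> j" "\<beta> $ i * v i \<theta> = max_bid v \<theta> \<beta>"
        "\<beta> $ j * v j \<theta> = max_bid v \<theta> \<beta>" "0 < v i \<theta>" unfolding tied_def by blast
      have "wins v i \<beta> \<theta> i" "\<not> wins v j \<beta> \<theta> i"
        using ij wins_favoured wins_ex1[of v j \<beta> \<theta>] by (metis, metis)
      then have "gain i j \<theta> = v i \<theta> * r \<theta>" by (simp add: gain_def winning_value_def)
      then show "r \<theta> = 0" using elim ij(4) by simp
    qed
  qed
qed

text \<open>Ties carry no supply under \<open>s\<close> or \<open>s'\<close>, so the pointwise
  gradients may be replaced by winning values, whose integrals are the gradients of the two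
  revenues.\<close>

lemma supply_shift_eq:
  assumes s: "Linf_plus M s" "Linf_plus M s'" and \<beta>: "\<And>i. 0 < \<beta> $ i"
    and D: "GDERIV (revenue M v s) \<beta> :> D" "GDERIV (revenue M v s') \<beta> :> D'"
  shows "supply_shift M v s s' \<beta> = D - D'"
proof -
  obtain k :: 'n where True by simp
  \<comment> \<open>At a tie \<open>grad\<close> is a description with no witness. All these
    descriptions are the same constant, so the integrand is measurable.\<close>
  define c where "c = (THE D :: real^'n. False)"
  have grad_cases: "grad (max_bid v \<theta>) \<beta> = (if tied v \<beta> \<theta> then c else winning_value v k \<beta> \<theta>)"
    if "\<theta> \<in> space M" for \<theta>
    using tied_imp_no_gradient[of v \<beta> \<theta>] grad_eq[OF max_bid_has_gradient[of v \<theta> \<beta> k]] v_nonneg[OF that] \<beta>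
    by (auto simp: grad_def c_def)
  have [measurable]: "(\<lambda>\<theta>. max_bid v \<theta> \<beta>) \<in> borel_measurable M"
    by (intro max_bid_measurable v_measurable)
  have [measurable]: "Measurable.pred M (tied v \<beta>)"
    unfolding tied_def[abs_def] by measurable
  have [measurable]: "s \<in> borel_measurable M" "s' \<in> borel_measurable M"
    using s unfolding Linf_plus_def by auto
  have wv_axis: "winning_value v k \<beta> \<theta> = (\<Sum>i\<in>UNIV. winning_value v k \<beta> \<theta> $ i *\<^sub>R axis i 1)" for \<theta>
    using basis_expansion[of "winning_value v k \<beta> \<theta>"] by (simp add: scalar_mult_eq_scaleR)
  have wv_meas[measurable]: "winning_value v k \<beta> \<in> borel_measurable M"
    by (subst wv_axis[abs_def]) measurable
  have ae: "AE \<theta> in M. (s \<theta> - s' \<theta>) *\<^sub>R grad (max_bid v \<theta>) \<beta>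
      = (\<Sum>i\<in>UNIV. (winning_value v k \<beta> \<theta> $ i * s \<theta> - winning_value v k \<beta> \<theta> $ i * s' \<theta>) *\<^sub>R axis i 1)"
    using tied_AE_no_supply[OF s(1) D(1)] tied_AE_no_supply[OF s(2) D(2)] AE_space
  proof eventually_elim
    case (elim \<theta>)
    have "(s \<theta> - s' \<theta>) *\<^sub>R grad (max_bid v \<theta>) \<beta> = (s \<theta> - s' \<theta>) *\<^sub>R winning_value v k \<beta> \<theta>"
      using elim grad_cases by auto
    also have "\<dots> = (\<Sum>i\<in>UNIV. (winning_value v k \<beta> \<theta> $ i * s \<theta> - winning_value v k \<beta> \<theta> $ i * s' \<theta>) *\<^sub>R axis i 1)"
      by (subst wv_axis) (simp add: scaleR_sum_right algebra_simps)
    finally show ?case .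
  qed
  have int: "integrable M (\<lambda>\<theta>. (winning_value v k \<beta> \<theta> $ i * s \<theta> - winning_value v k \<beta> \<theta> $ i * s' \<theta>)
      *\<^sub>R (axis i 1 :: real^'n))" for i
    using integrable_winning_value s by simp
  have "supply_shift M v s s' \<beta> =
    (\<integral>\<theta>. (\<Sum>i\<in>UNIV. (winning_value v k \<beta> \<theta> $ i * s \<theta> - winning_value v k \<beta> \<theta> $ i * s' \<theta>) *\<^sub>R axis i 1) \<partial>M)"
    unfolding supply_shift_def
  proof (rule integral_cong_AE)
    have "(\<lambda>\<theta>. (s \<theta> - s' \<theta>) *\<^sub>R (if tied v \<beta> \<theta> then c else winning_value v k \<beta> \<theta>)) \<in> borel_measurable M"
      by measurable
    then show "(\<lambda>\<theta>. (s \<theta> - s' \<theta>) *\<^sub>R grad (max_bid v \<theta>) \<beta>) \<in> borel_measurable M"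
      by (rule measurable_cong[THEN iffD2, rotated]) (simp add: grad_cases)
  qed (use ae in \<open>simp_all\<close>)
  also have "\<dots> = (\<Sum>i\<in>UNIV. (revenue_subgradient M v s k \<beta> - revenue_subgradient M v s' k \<beta>) $ i *\<^sub>R axis i 1)"
    using int integrable_winning_value[OF s(1)] integrable_winning_value[OF s(2)]
    by (subst Bochner_Integration.integral_sum) (auto simp: revenue_subgradient_def)
  also have "\<dots> = revenue_subgradient M v s k \<beta> - revenue_subgradient M v s' k \<beta>"
    using basis_expansion[of "revenue_subgradient M v s k \<beta> - revenue_subgradient M v s' k \<beta>"]
    by (simp add: scalar_mult_eq_scaleR)
  finally show ?thesis using revenue_gradient s D by simp
qed

text \<open>The spend in this allocation is \<open>\<beta> $ i * D $ i\<close>, so the first-order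
  conditions of the program read as budget feasibility and complementary slackness. It carries
  strict slackness, stated for equilibria, over to gradients.\<close>

lemma fppe_if_stationary:
  fixes k :: 'n
  assumes r: "Linf_plus M r" and D: "GDERIV (revenue M v r) \<beta> :> D"
    and \<beta>: "\<And>i. 0 < \<beta> $ i \<and> \<beta> $ i \<le> 1"
    and le: "\<And>i. \<beta> $ i * D $ i \<le> b $ i" and eq: "\<And>i. \<beta> $ i < 1 \<Longrightarrow> \<beta> $ i * D $ i = b $ i"
  defines "p \<equiv> \<lambda>\<theta>. max_bid v \<theta> \<beta>" and "x \<equiv> \<lambda>i \<theta>. of_bool (wins v k \<beta> \<theta> i) :: real"
  shows "fppe M b v r \<beta> p x" and "spend M r p x i = \<beta> $ i * D $ i"
proof -
  note measurable_wins[measurable]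
  have sp: "spend M r p x i = \<beta> $ i * D $ i" for i
  proof -
    have "(\<lambda>\<theta>. x i \<theta> * p \<theta> * r \<theta>) = (\<lambda>\<theta>. \<beta> $ i * (winning_value v k \<beta> \<theta> $ i * r \<theta>))"
      using wins_imp_max_bid[of v k \<beta> _ i] by (auto simp: x_def p_def winning_value_def fun_eq_iff)
    then have "spend M r p x i = \<beta> $ i * revenue_subgradient M v r k \<beta> $ i"
      unfolding spend_def revenue_subgradient_def by simp
    then show ?thesis using revenue_gradient[OF r D] by simp
  qed
  show "spend M r p x i = \<beta> $ i * D $ i" by (rule sp)
  have "0 \<le> p \<theta>" if "\<theta> \<in> space M" for \<theta>
  proof -
    have "0 \<le> \<beta> $ k * v k \<theta>" using \<beta>[of k] v_nonneg[OF that, of k] by simp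
    then show ?thesis using max_bid_ge[of \<beta> k v \<theta>] by (simp add: p_def)
  qed
  then have p: "L1_plus M p"
    unfolding L1_plus_def p_def by (auto intro: integrable_max_bid v_integrable)
  have sum: "(\<Sum>i\<in>UNIV. x i \<theta>) = 1" for \<theta>
  proof -
    obtain i where "wins v k \<beta> \<theta> i" using wins_ex1[of v k \<beta> \<theta>] by auto
    from sum_wins[OF this, of "\<lambda>_. 1"] show ?thesis by (simp add: x_def)
  qed
  have xm: "x i \<in> borel_measurable M" for i unfolding x_def by measurable
  show "fppe M b v r \<beta> p x"
    unfolding fppe_def sp
    using p sum xm \<beta> le eq
    by (auto simp: x_def p_def less_imp_le wins_imp_max_bid) (metis order_le_less order_less_irrefl)+
qed

end

section \<open>The Eisenberg--Gale objective\<close>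

definition log_barrier :: "real^'n \<Rightarrow> real^'n \<Rightarrow> real" where
  "log_barrier b x = (\<Sum>i\<in>UNIV. b $ i * ln (x $ i))"

lemma log_barrier_gradient:
  assumes "\<And>i. 0 < x $ i"
  shows "GDERIV (log_barrier b) x :> (\<chi> i. b $ i / x $ i)"
proof -
  have "((\<lambda>x. b $ i * ln (x $ i)) has_derivative (\<lambda>h. b $ i * (h $ i * (1 / x $ i)))) (at x)" for i
    by (intro has_derivative_mult_right DERIV_compose_FDERIV[where f = ln] DERIV_ln_divide assms
        bounded_linear_imp_has_derivative bounded_linear_vec_nth)
  then have "(log_barrier b has_derivative (\<lambda>h. \<Sum>i\<in>UNIV. b $ i * (h $ i * (1 / x $ i)))) (at x)"
    unfolding log_barrier_def by (rule has_derivative_sum)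
  moreover have "(\<lambda>h. \<Sum>i\<in>UNIV. b $ i * (h $ i * (1 / x $ i))) = (\<lambda>h. h \<bullet> (\<chi> i. b $ i / x $ i))"
    by (simp add: inner_vec_def mult.commute)
  ultimately show ?thesis by (simp add: gderiv_def)
qed

text \<open>The derivative is diagonal. Writing it as a combination of the fixed operators
  \<open>C i\<close> reduces continuity in operator norm to continuity of the scalar
  coefficients.\<close>

lemma log_barrier_gradient_C1:
  fixes b :: "real^'n"
  obtains D where
    "\<And>x. (\<And>i. 0 < x $ i) \<Longrightarrow>
      ((\<lambda>x. \<chi> i. b $ i / x $ i) has_derivative blinfun_apply (D x)) (at x)"
    "continuous_on {x. \<forall>i. 0 < x $ i} D"
    "\<And>x h. D x h = (\<chi> i. - (b $ i / (x $ i)\<^sup>2) * h $ i)"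
proof -
  define C where "C i = Blinfun (\<lambda>h :: real^'n. h $ i *\<^sub>R axis i (1::real))" for i :: 'n
  have C: "C i h = h $ i *\<^sub>R axis i 1" for i h
    unfolding C_def by (subst bounded_linear_Blinfun_apply)
      (auto intro: bounded_linear_scaleR_const bounded_linear_vec_nth)
  define D where "D x = (\<Sum>i\<in>UNIV. - (b $ i / (x $ i)\<^sup>2) *\<^sub>R C i)" for x
  have axis: "(\<Sum>i\<in>UNIV. y i *\<^sub>R axis i 1) = (\<chi> i. y i)" for y :: "'n \<Rightarrow> real"
    using basis_expansion[of "\<chi> i. y i"] by (simp add: scalar_mult_eq_scaleR)
  have D: "D x h = (\<chi> i. - (b $ i / (x $ i)\<^sup>2) * h $ i)" for x h
    by (simp add: D_def blinfun.sum_left blinfun.minus_left blinfun.scaleR_left C flip: axis)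
  show thesis
  proof
    show "((\<lambda>x. \<chi> i. b $ i / x $ i) has_derivative blinfun_apply (D x)) (at x)"
      if x: "\<And>i. 0 < x $ i" for x
    proof -
      have "((\<lambda>x. b $ i / x $ i) has_derivative (\<lambda>h. h $ i * - (b $ i / (x $ i)\<^sup>2))) (at x)" for i
        by (rule DERIV_compose_FDERIV[where f = "\<lambda>y. b $ i / y"])
          (use x[of i] in \<open>auto intro!: derivative_eq_intros bounded_linear_imp_has_derivative
             bounded_linear_vec_nth simp: power2_eq_square\<close>)
      then have "((\<lambda>x. \<Sum>i\<in>UNIV. (b $ i / x $ i) *\<^sub>R (axis i 1 :: real^'n)) has_derivative
          (\<lambda>h. \<Sum>i\<in>UNIV. (h $ i * - (b $ i / (x $ i)\<^sup>2)) *\<^sub>R axis i 1)) (at x)"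
        by (intro has_derivative_sum has_derivative_scaleR_left)
      then show ?thesis unfolding axis by (rule has_derivative_eq_rhs) (simp add: D mult.commute fun_eq_iff)
    qed
    show "continuous_on {x. \<forall>i. 0 < x $ i} D"
      unfolding D_def[abs_def] by (intro continuous_intros) (metis less_irrefl mem_Collect_eq power2_less_0 power_eq_0_iff)
  qed (rule D)
qed

text \<open>The squared midpoint equals \<open>x * y + t\<close> with
  \<open>t = (x - y)\<^sup>2 / 4\<close>, which is at least \<open>x * y * (1 + t)\<close> since
  \<open>x * y \<le> 1\<close>. As \<open>t \<le> 1/4\<close>,
  \<open>ln (1 + t) \<ge> t / 2\<close>; halving the logarithm of the square leaves
  \<open>t / 4\<close>, the source of 1/16.\<close>

lemma ln_midpoint_ge:
  fixes x y :: real
  assumes "0 < x" "x \<le> 1" "0 < y" "y \<le> 1"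
  shows "(ln x + ln y) / 2 + (x - y)\<^sup>2 / 16 \<le> ln ((x + y) / 2)"
proof -
  define t where "t = (x - y)\<^sup>2 / 4"
  have "\<bar>x - y\<bar> \<le> 1" using assms by (simp add: abs_if)
  then have "(x - y)\<^sup>2 \<le> 1" by (simp add: abs_square_le_1)
  then have t: "0 \<le> t" "t \<le> 1" by (simp_all add: t_def)
  have "x * y \<le> 1" using assms by (simp add: mult_le_one)
  have "t / 2 \<le> t - t\<^sup>2"
    using t assms \<open>(x - y)\<^sup>2 \<le> 1\<close> mult_left_mono[of t "1/2" t] by (simp add: power2_eq_square t_def)
  also have "\<dots> \<le> ln (1 + t)" using t by (rule ln_one_plus_pos_lower_bound)
  finally have "ln x + ln y + t / 2 \<le> ln (x * y) + ln (1 + t)" using assms by (simp add: ln_mult)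
  also have "\<dots> = ln (x * y * (1 + t))" using assms t by (simp add: ln_mult)
  also have "\<dots> \<le> ln (((x + y) / 2)\<^sup>2)"
  proof (rule ln_mono)
    have "x * y * t \<le> 1 * t" using \<open>x * y \<le> 1\<close> t by (intro mult_right_mono) auto
    moreover have "((x + y) / 2)\<^sup>2 = x * y + t" by (simp add: t_def power2_eq_square field_simps)
    ultimately show "x * y * (1 + t) \<le> ((x + y) / 2)\<^sup>2" by (simp add: algebra_simps)
    show "0 < x * y * (1 + t)" using assms t by simp
  qed
  also have "\<dots> = 2 * ln ((x + y) / 2)" using assms by (simp add: ln_realpow)
  finally show ?thesis by (simp add: t_def field_simps)
qed

definition unit_box :: "(real^'n) set" where
  "unit_box = {\<gamma>. \<forall>i. 0 < \<gamma> $ i \<and> \<gamma> $ i \<le> 1}"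

lemma is_eg_minimizer_iff:
  "is_eg_minimizer M b v r \<beta> \<longleftrightarrow>
     \<beta> \<in> unit_box \<and> (\<forall>\<gamma>\<in>unit_box. eg_objective M b v r \<beta> \<le> eg_objective M b v r \<gamma>)"
  unfolding is_eg_minimizer_def is_arg_min_linorder unit_box_def by auto

text \<open>Only moves of one coordinate are tested: lowering it a little is always admissible,
  raising it only below one. Convexity does not enter, so signed supplies are covered.\<close>

lemma is_eg_minimizer_stationary:
  assumes min: "is_eg_minimizer M b v r \<beta>" and g: "GDERIV (eg_objective M b v r) \<beta> :> g"
  shows "g $ i \<le> 0" and "\<beta> $ i < 1 \<Longrightarrow> g $ i = 0"
proof -
  define \<phi> where "\<phi> t = eg_objective M b v r (\<beta> + t *\<^sub>R axis i 1)" for t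
  have "((\<lambda>t. \<beta> + t *\<^sub>R axis i 1) has_derivative (\<lambda>t. t *\<^sub>R axis i 1)) (at 0)"
    by (auto intro!: derivative_eq_intros)
  then have "(\<phi> has_derivative (\<lambda>t. (t *\<^sub>R axis i 1) \<bullet> g)) (at 0)"
    unfolding \<phi>_def by (rule has_derivative_compose) (use g in \<open>simp add: gderiv_def\<close>)
  then have der: "(\<phi> has_real_derivative g $ i) (at 0)"
    by (simp add: has_field_derivative_def inner_axis' mult_commute_abs)
  have \<beta>: "\<And>j. 0 < \<beta> $ j \<and> \<beta> $ j \<le> 1" using min by (simp add: is_eg_minimizer_iff unit_box_def)
  have le: "\<phi> 0 \<le> \<phi> t" if "0 < \<beta> $ i + t" "\<beta> $ i + t \<le> 1" for t
  proof -
    have "\<beta> + t *\<^sub>R axis i 1 \<in> unit_box"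
      using \<beta> that by (auto simp: unit_box_def axis_def)
    then show ?thesis using min by (simp add: \<phi>_def is_eg_minimizer_iff)
  qed
  show le0: "g $ i \<le> 0"
  proof (rule ccontr)
    assume "\<not> g $ i \<le> 0"
    then obtain d where "d > 0" "\<And>t. 0 < t \<Longrightarrow> t < d \<Longrightarrow> \<phi> (- t) < \<phi> 0"
      using DERIV_pos_inc_left[OF der] by auto
    moreover define t where "t = min (d / 2) (\<beta> $ i / 2)"
    ultimately have "0 < t" "t < d" "t < \<beta> $ i" "\<And>t. 0 < t \<Longrightarrow> t < d \<Longrightarrow> \<phi> (- t) < \<phi> 0"
      using \<beta>[of i] by auto
    then show False using le[of "- t"] \<beta>[of i] by fastforce
  qed
  show "g $ i = 0" if "\<beta> $ i < 1"
  proof (rule ccontr)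
    assume "g $ i \<noteq> 0"
    then obtain d where "d > 0" "\<And>t. 0 < t \<Longrightarrow> t < d \<Longrightarrow> \<phi> t < \<phi> 0"
      using DERIV_neg_dec_right[OF der] le0 by force
    moreover define t where "t = min (d / 2) ((1 - \<beta> $ i) / 2)"
    moreover have "t \<le> (1 - \<beta> $ i) / 2" unfolding t_def by (rule min.cobounded2)
    ultimately have "0 < t" "t < d" "t \<le> (1 - \<beta> $ i) / 2" "\<And>t. 0 < t \<Longrightarrow> t < d \<Longrightarrow> \<phi> t < \<phi> 0"
      using that by auto
    then show False using le[of t] \<beta>[of i] by fastforce
  qed
qed

section \<open>Existence and localisation of minimizers\<close>

locale market = bidders M v for M :: "'t measure" and v :: "'n::finite \<Rightarrow> 't \<Rightarrow> real" +
  fixes b :: "real^'n" and s s' :: "'t \<Rightarrow> real"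
  assumes budgets: "0 < b $ i"
    and s: "Linf_plus M s" "(\<integral>\<theta>. s \<theta> \<partial>M) = 1"
    and s': "Linf_plus M s'" "(\<integral>\<theta>. s' \<theta> \<partial>M) = 1"
begin

abbreviation mix_objective :: "real \<Rightarrow> real^'n \<Rightarrow> real" where
  "mix_objective \<alpha> \<equiv> eg_objective M b v (mix_supply s s' \<alpha>)"

abbreviation minimizer :: "real \<Rightarrow> real^'n \<Rightarrow> bool" where
  "minimizer \<alpha> \<equiv> is_eg_minimizer M b v (mix_supply s s' \<alpha>)"

lemma eg_objective_revenue:
  "eg_objective M b v s \<gamma> = revenue M v s \<gamma> - log_barrier b \<gamma>"
  "eg_objective M b v s' \<gamma> = revenue M v s' \<gamma> - log_barrier b \<gamma>"
  using eg_objective_eq[OF v_integrable s] eg_objective_eq[OF v_integrable s']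
  by (simp_all add: revenue_def log_barrier_def)

lemma integrable_eg_integrand:
  assumes r: "Linf_plus M r" "(\<integral>\<theta>. r \<theta> \<partial>M) = 1"
  shows "integrable M (\<lambda>\<theta>. eg_integrand b v \<theta> \<gamma> * r \<theta>)"
proof -
  have "integrable M r" using r(2) by (metis not_integrable_integral_eq zero_neq_one)
  then show ?thesis
    using integrable_revenue[OF r(1), of \<gamma>] by (simp add: eg_integrand_def left_diff_distrib)
qed

lemma mix_objective_affine:
  "mix_objective \<alpha> \<gamma> = eg_objective M b v s \<gamma> + \<alpha> * (eg_objective M b v s' \<gamma> - eg_objective M b v s \<gamma>)"
proof -
  have "mix_objective \<alpha> \<gamma> = (\<integral>\<theta>. \<alpha> * (eg_integrand b v \<theta> \<gamma> * s' \<theta>) + (1 - \<alpha>) * (eg_integrand b v \<theta> \<gamma> * s \<theta>) \<partial>M)"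
    unfolding eg_objective_def mix_supply_def by (simp add: algebra_simps)
  also have "\<dots> = \<alpha> * eg_objective M b v s' \<gamma> + (1 - \<alpha>) * eg_objective M b v s \<gamma>"
    unfolding eg_objective_def
    by (subst Bochner_Integration.integral_add)
      (auto intro!: integrable_mult_right integrable_eg_integrand s s')
  finally show ?thesis by (simp add: algebra_simps)
qed

text \<open>Both supplies have total mass one, so the barrier is the same for every \<alpha> and the
  perturbation touches only the revenue.\<close>

lemma mix_objective_eq:
  "mix_objective \<alpha> \<gamma> = revenue M v s \<gamma> + \<alpha> * (revenue M v s' \<gamma> - revenue M v s \<gamma>) - log_barrier b \<gamma>"
  by (simp add: mix_objective_affine eg_objective_revenue)

text \<open>The box is not closed, but the revenue is continuous on the whole space, hence bounded
  on the compact cube containing the box.\<close>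

lemma revenue_bounded:
  obtains C where "0 < C" "\<And>\<gamma>. \<gamma> \<in> unit_box \<Longrightarrow> \<bar>revenue M v s \<gamma>\<bar> \<le> C \<and> \<bar>revenue M v s' \<gamma>\<bar> \<le> C"
proof -
  have "bounded (revenue M v s ` cbox 0 (vec 1))" "bounded (revenue M v s' ` cbox 0 (vec 1))"
    using continuous_on_revenue s(1) s'(1)
    by (auto intro!: compact_imp_bounded compact_continuous_image intro: continuous_on_subset)
  then obtain A B where "0 < A" "0 < B"
    "\<And>\<gamma>. \<gamma> \<in> cbox 0 (vec 1) \<Longrightarrow> \<bar>revenue M v s \<gamma>\<bar> \<le> A"
    "\<And>\<gamma>. \<gamma> \<in> cbox 0 (vec 1) \<Longrightarrow> \<bar>revenue M v s' \<gamma>\<bar> \<le> B"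
    unfolding bounded_pos by (auto simp: Ball_def)
  moreover have "unit_box \<subseteq> cbox 0 (vec 1 :: real^'n)"
    by (auto simp: unit_box_def mem_box_cart) (metis less_imp_le)
  ultimately have "0 < max A B"
    "\<And>\<gamma>. \<gamma> \<in> unit_box \<Longrightarrow> \<bar>revenue M v s \<gamma>\<bar> \<le> max A B \<and> \<bar>revenue M v s' \<gamma>\<bar> \<le> max A B"
    by (simp_all add: le_max_iff_disj subset_iff)
  then show thesis by (rule that)
qed

lemma budgets_lower_bound: obtains m where "0 < m" "\<And>i. m \<le> b $ i"
proof
  show "0 < Min (range (\<lambda>i. b $ i))" using budgets by simp
  show "Min (range (\<lambda>i. b $ i)) \<le> b $ i" for i by simp
qed

text \<open>The barrier makes small coordinates more expensive than the point \<open>vec 1\<close>,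
  so a minimizer over a compact subcube is a minimizer over the whole box, whatever the sign of
  \<alpha>.\<close>

lemma minimizer_exists:
  assumes "\<bar>\<alpha>\<bar> \<le> 1"
  shows "\<exists>\<beta>. minimizer \<alpha> \<beta>"
proof -
  obtain C where C: "0 < C" "\<And>\<gamma>. \<gamma> \<in> unit_box \<Longrightarrow> \<bar>revenue M v s \<gamma>\<bar> \<le> C \<and> \<bar>revenue M v s' \<gamma>\<bar> \<le> C"
    using revenue_bounded by blast
  obtain m where m: "0 < m" "\<And>i. m \<le> b $ i" using budgets_lower_bound by blast
  define mix where "mix \<gamma> = revenue M v s \<gamma> + \<alpha> * (revenue M v s' \<gamma> - revenue M v s \<gamma>)" for \<gamma>
  have mix: "\<bar>mix \<gamma>\<bar> \<le> 3 * C" if "\<gamma> \<in> unit_box" for \<gamma>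
  proof -
    have "\<bar>\<alpha> * (revenue M v s' \<gamma> - revenue M v s \<gamma>)\<bar> \<le> 1 * (2 * C)"
      unfolding abs_mult using assms C(2)[OF that] by (intro mult_mono) auto
    then show ?thesis using C(2)[OF that] unfolding mix_def by linarith
  qed
  \<comment> \<open>Mixed revenue stays within \<open>3 * C\<close> of zero, so its values differ by
    at most \<open>6 * C\<close>. A coordinate below \<open>\<eta>\<close> costs at least
    \<open>6 * C + 1\<close> in the barrier, which vanishes at \<open>vec 1\<close>.\<close>
  define \<eta> where "\<eta> = exp (- (6 * C + 1) / m)"
  define Q where "Q = cbox (vec \<eta>) (vec 1 :: real^'n)"
  have \<eta>: "0 < \<eta>" "\<eta> \<le> 1"
    unfolding \<eta>_def using C(1) m(1) by (simp, subst exp_le_one_iff, intro divide_nonpos_pos, auto)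
  have one: "vec 1 \<in> Q" using \<eta> by (simp add: Q_def mem_box_cart)
  have Q: "\<gamma> \<in> unit_box" if "\<gamma> \<in> Q" for \<gamma>
    using that \<eta>(1) by (auto simp: Q_def mem_box_cart unit_box_def intro: less_le_trans)
  have "continuous_on Q (mix_objective \<alpha>)"
    unfolding mix_objective_eq[abs_def] log_barrier_def
    using continuous_on_revenue s(1) s'(1) Q
    by (intro continuous_intros) (auto intro: continuous_on_subset simp: unit_box_def less_imp_neq[symmetric])
  then obtain \<beta> where \<beta>: "\<beta> \<in> Q" "\<And>\<gamma>. \<gamma> \<in> Q \<Longrightarrow> mix_objective \<alpha> \<beta> \<le> mix_objective \<alpha> \<gamma>"
    using continuous_attains_inf[of Q "mix_objective \<alpha>"] one by (auto simp: Q_def)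
  have "mix_objective \<alpha> \<beta> \<le> mix_objective \<alpha> \<gamma>" if \<gamma>: "\<gamma> \<in> unit_box" for \<gamma>
  proof (cases "\<gamma> \<in> Q")
    case False
    then obtain i where i: "\<gamma> $ i < \<eta>" using \<gamma> by (auto simp: Q_def mem_box_cart unit_box_def not_le) (meson not_le)
    have nonneg: "0 \<le> - (b $ j * ln (\<gamma> $ j))" for j
      using \<gamma> budgets[of j] by (simp add: unit_box_def mult_nonneg_nonpos)
    have "6 * C + 1 = m * - ln \<eta>" using m(1) by (simp add: \<eta>_def)
    also have "\<dots> \<le> b $ i * - ln \<eta>" using m(2) \<eta> by (intro mult_right_mono) auto
    also have "\<dots> \<le> b $ i * - ln (\<gamma> $ i)"
      using i \<gamma> \<eta> budgets[of i] by (intro mult_left_mono) (auto simp: unit_box_def)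
    also have "\<dots> \<le> (\<Sum>j\<in>UNIV. - (b $ j * ln (\<gamma> $ j)))"
      using member_le_sum[of i UNIV "\<lambda>j. - (b $ j * ln (\<gamma> $ j))"] nonneg by simp
    finally have "6 * C + 1 \<le> - log_barrier b \<gamma>" by (simp add: log_barrier_def sum_negf)
    then have "mix_objective \<alpha> (vec 1) \<le> mix_objective \<alpha> \<gamma>"
      using mix[OF \<gamma>] mix[OF Q[OF one]]
      by (simp add: mix_objective_eq mix_def[symmetric]) (simp add: log_barrier_def)
    then show ?thesis using \<beta>(2)[OF one] by linarith
  qed (use \<beta> in blast)
  then show ?thesis using \<beta> Q by (auto simp: is_eg_minimizer_iff)
qed

text \<open>Comparing with the midpoint gives quadratic growth at rate \<open>m / 8\<close> of the
  objective at 0, while \<open>\<gamma>\<close> minimizes that objective up to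
  \<open>4 * C * \<bar>\<alpha>\<bar>\<close>; the quotient is the constant
  \<open>32 * C / m\<close>.\<close>

lemma minimizers_near:
  obtains K where "0 \<le> K"
    "\<And>\<alpha> \<beta> \<gamma>. minimizer 0 \<beta> \<Longrightarrow> minimizer \<alpha> \<gamma> \<Longrightarrow> (norm (\<gamma> - \<beta>))\<^sup>2 \<le> K * \<bar>\<alpha>\<bar>"
proof -
  obtain C where C: "0 < C" "\<And>\<gamma>. \<gamma> \<in> unit_box \<Longrightarrow> \<bar>revenue M v s \<gamma>\<bar> \<le> C \<and> \<bar>revenue M v s' \<gamma>\<bar> \<le> C"
    using revenue_bounded by blast
  obtain m where m: "0 < m" "\<And>i. m \<le> b $ i" using budgets_lower_bound by blast
  show thesis
  proof (rule that)
    show "0 \<le> 32 * C / m" using C m by simp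
    fix \<alpha> \<beta> \<gamma>
    assume \<beta>: "minimizer 0 \<beta>" and \<gamma>: "minimizer \<alpha> \<gamma>"
    define z where "z = (1 - 1 / 2) *\<^sub>R \<beta> + (1 / 2) *\<^sub>R \<gamma>"
    have box: "\<beta> \<in> unit_box" "\<gamma> \<in> unit_box" using \<beta> \<gamma> by (simp_all add: is_eg_minimizer_iff)
    have z: "z \<in> unit_box"
      unfolding unit_box_def
    proof (intro CollectI allI)
      fix i
      have "0 < \<beta> $ i" "\<beta> $ i \<le> 1" "0 < \<gamma> $ i" "\<gamma> $ i \<le> 1" using box by (auto simp: unit_box_def)
      then show "0 < z $ i \<and> z $ i \<le> 1" by (simp add: z_def)
    qed
    have perturb: "\<bar>mix_objective \<alpha> x - mix_objective 0 x\<bar> \<le> \<bar>\<alpha>\<bar> * (2 * C)" if "x \<in> unit_box" for x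
      using C(2)[OF that] by (auto simp: mix_objective_eq abs_mult intro!: mult_left_mono)
    have "m / 16 * (norm (\<gamma> - \<beta>))\<^sup>2 = (\<Sum>i\<in>UNIV. m * (\<beta> $ i - \<gamma> $ i)\<^sup>2 / 16)"
      by (simp add: norm_vec_def L2_set_def sum_nonneg sum_distrib_left power2_commute)
    also have "\<dots> \<le> (\<Sum>i\<in>UNIV. b $ i * ((\<beta> $ i - \<gamma> $ i)\<^sup>2 / 16))"
      using m(2) by (intro sum_mono) (auto intro!: mult_right_mono)
    also have "\<dots> \<le> (\<Sum>i\<in>UNIV. b $ i * (ln (z $ i) - (ln (\<beta> $ i) + ln (\<gamma> $ i)) / 2))"
    proof (intro sum_mono mult_left_mono)
      fix i
      show "(\<beta> $ i - \<gamma> $ i)\<^sup>2 / 16 \<le> ln (z $ i) - (ln (\<beta> $ i) + ln (\<gamma> $ i)) / 2"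
        using ln_midpoint_ge[of "\<beta> $ i" "\<gamma> $ i"] box
        by (simp add: unit_box_def z_def add_divide_distrib algebra_simps)
      show "0 \<le> b $ i" using budgets[of i] by simp
    qed
    also have "\<dots> = log_barrier b z - (log_barrier b \<beta> + log_barrier b \<gamma>) / 2"
      by (simp add: log_barrier_def sum_subtractf sum.distrib right_diff_distrib distrib_left
          flip: sum_divide_distrib)
    finally have "m / 16 * (norm (\<gamma> - \<beta>))\<^sup>2 \<le> log_barrier b z - (log_barrier b \<beta> + log_barrier b \<gamma>) / 2" .
    moreover have "revenue M v s z \<le> (1 - 1 / 2) * revenue M v s \<beta> + 1 / 2 * revenue M v s \<gamma>"
      unfolding z_def by (rule convex_onD[OF convex_revenue[OF s(1)]]) auto
    moreover have "mix_objective 0 \<beta> \<le> mix_objective 0 z"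
      using \<beta> z by (simp add: is_eg_minimizer_iff)
    ultimately have "m / 8 * (norm (\<gamma> - \<beta>))\<^sup>2 \<le> mix_objective 0 \<gamma> - mix_objective 0 \<beta>"
      unfolding mix_objective_eq mult_zero_left add_0_right by argo
    also have "\<dots> \<le> (mix_objective \<alpha> \<gamma> + \<bar>\<alpha>\<bar> * (2 * C)) - (mix_objective \<alpha> \<beta> - \<bar>\<alpha>\<bar> * (2 * C))"
      using perturb[OF box(1)] perturb[OF box(2)] by linarith
    also have "\<dots> \<le> 4 * C * \<bar>\<alpha>\<bar>" using \<gamma> box by (simp add: is_eg_minimizer_iff)
    finally show "(norm (\<gamma> - \<beta>))\<^sup>2 \<le> 32 * C / m * \<bar>\<alpha>\<bar>" using m(1) by (simp add: field_simps)
  qed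
qed

lemma minimizer_0_unique:
  assumes "minimizer 0 \<beta>" "minimizer 0 \<gamma>"
  shows "\<gamma> = \<beta>"
proof -
  obtain K where "0 \<le> K" and K: "\<And>\<alpha> \<beta> \<gamma>. minimizer 0 \<beta> \<Longrightarrow> minimizer \<alpha> \<gamma> \<Longrightarrow> (norm (\<gamma> - \<beta>))\<^sup>2 \<le> K * \<bar>\<alpha>\<bar>"
    using minimizers_near by blast
  have "(norm (\<gamma> - \<beta>))\<^sup>2 \<le> K * \<bar>0\<bar>" by (rule K[OF assms])
  then show "\<gamma> = \<beta>" by simp
qed

lemma pacing_eq_minimizer: "(\<And>\<gamma>. minimizer \<alpha> \<gamma> \<Longrightarrow> \<gamma> = \<beta>) \<Longrightarrow> minimizer \<alpha> \<beta> \<Longrightarrow>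
  pacing M b v (mix_supply s s' \<alpha>) = \<beta>"
  unfolding pacing_def by (rule the_equality)

end

section \<open>Sensitivity of the multipliers\<close>

text \<open>\<open>hess\<close> differentiates \<open>grad\<close>, so the gradient must be known on
  a neighbourhood of \<open>x\<close>; this is why an open \<open>W\<close> appears.\<close>

lemma hess_mult_vec:
  assumes "open W" "x \<in> W" and g: "\<And>y. y \<in> W \<Longrightarrow> GDERIV g y :> G y"
    and G: "(G has_derivative D) (at x)"
  shows "hess g x *v h = D h"
proof -
  have "(grad g has_derivative D) (at x)"
    by (rule has_derivative_transform_within_open[OF G assms(1,2)]) (use grad_eq[OF g] in simp)
  then have "frechet_derivative (grad g) (at x) = D" by (rule frechet_derivative_at[symmetric])
  then show ?thesis
    using has_derivative_linear[OF G] by (simp add: hess_def jacobian_def matrix_works)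
qed

lemma unpaced_proj_mult_vec: "(unpaced_proj \<beta> *v h) $ i = (if \<beta> $ i < 1 then h $ i else 0)"
proof -
  have "(unpaced_proj \<beta> *v h) $ i = (\<Sum>j\<in>UNIV. if j = i then (if \<beta> $ i < 1 then h $ i else 0) else 0)"
    unfolding matrix_vector_mult_def unpaced_proj_def vec_lambda_beta by (rule sum.cong) auto
  then show ?thesis by simp
qed

lemma unpaced_proj_idem: "unpaced_proj \<beta> ** unpaced_proj \<beta> = unpaced_proj \<beta>"
  by (simp add: matrix_eq matrix_vector_mul_assoc[symmetric] unpaced_proj_mult_vec vec_eq_iff)

lemma unpaced_proj_transpose: "transpose (unpaced_proj \<beta>) = unpaced_proj \<beta>"
  by (auto simp: transpose_def unpaced_proj_def vec_eq_iff)

section \<open>From derivatives to the two limits of the theorem\<close>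

lemma has_vector_derivative_imp_backward_quotient:
  assumes "(f has_vector_derivative V) (at a)"
  shows "((\<lambda>\<epsilon>. (f (a - \<epsilon>) - f a) /\<^sub>R \<epsilon>) \<longlongrightarrow> - V) (at_right 0)"
proof -
  have "((\<lambda>h. norm (f (a + h) - f a - h *\<^sub>R V) / norm h) \<longlongrightarrow> 0) (at 0)"
    using assms unfolding has_vector_derivative_def has_derivative_at by blast
  moreover have "filterlim (\<lambda>\<epsilon>. - \<epsilon> :: real) (at 0) (at_right 0)"
    unfolding filterlim_at by (auto intro!: tendsto_eq_intros simp: eventually_at_filter)
  ultimately have "((\<lambda>\<epsilon>. norm (f (a + - \<epsilon>) - f a - (- \<epsilon>) *\<^sub>R V) / norm (- \<epsilon>)) \<longlongrightarrow> 0) (at_right 0)"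
    by (rule filterlim_compose)
  then have "((\<lambda>\<epsilon>. norm ((f (a - \<epsilon>) - f a) /\<^sub>R \<epsilon> - - V)) \<longlongrightarrow> 0) (at_right 0)"
  proof (rule tendsto_cong[THEN iffD1, rotated])
    show "\<forall>\<^sub>F \<epsilon> in at_right 0. norm (f (a + - \<epsilon>) - f a - (- \<epsilon>) *\<^sub>R V) / norm (- \<epsilon>)
        = norm ((f (a - \<epsilon>) - f a) /\<^sub>R \<epsilon> - - V)"
      using eventually_at_right_less[of "0::real"]
    proof eventually_elim
      case (elim \<epsilon>)
      have "(f (a - \<epsilon>) - f a) /\<^sub>R \<epsilon> - - V = (f (a + - \<epsilon>) - f a - (- \<epsilon>) *\<^sub>R V) /\<^sub>R \<epsilon>"
        using elim by (simp add: scaleR_add_right)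
      then show ?case using elim by (simp add: divide_inverse mult.commute)
    qed
  qed
  then show ?thesis by (metis LIM_zero_iff tendsto_norm_zero_iff)
qed

text \<open>The error splits into the Taylor remainder at 0 and \<open>t\<close> times
  \<open>V t - V 0\<close>; the second part is small only by continuity of \<open>V\<close> at
  0.\<close>

lemma first_order_expansion_at_moving_point:
  assumes f: "(f has_vector_derivative V 0) (at 0)" and V: "(V \<longlongrightarrow> V 0) (nhds 0)"
  shows "(\<lambda>t. norm (f t - t *\<^sub>R V t - f 0)) \<in> o[at_right 0](\<lambda>t. t)"
proof (rule smalloI_tendsto)
  have le: "at_right 0 \<le> at (0::real)" "at_right 0 \<le> nhds (0::real)"
    by (rule at_le, simp) (simp add: at_within_def)
  have "((\<lambda>h. norm (f (0 + h) - f 0 - h *\<^sub>R V 0) / norm h) \<longlongrightarrow> 0) (at 0)"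
    using f unfolding has_vector_derivative_def has_derivative_at by blast
  then have 1: "((\<lambda>h. norm (f h - f 0 - h *\<^sub>R V 0) / norm h) \<longlongrightarrow> 0) (at_right 0)"
    using tendsto_mono[OF le(1)] by fastforce
  have "((\<lambda>h. norm (V h - V 0)) \<longlongrightarrow> 0) (at_right 0)"
    using tendsto_mono[OF le(2) V] by (metis LIM_zero tendsto_norm_zero)
  with 1 have 2: "((\<lambda>h. norm (f h - f 0 - h *\<^sub>R V 0) / norm h + norm (V h - V 0)) \<longlongrightarrow> 0) (at_right 0)"
    using tendsto_add by fastforce
  show "((\<lambda>t. norm (f t - t *\<^sub>R V t - f 0) / t) \<longlongrightarrow> 0) (at_right 0)"
  proof (rule tendsto_sandwich[OF _ _ tendsto_const 2])
    show "\<forall>\<^sub>F t in at_right 0. 0 \<le> norm (f t - t *\<^sub>R V t - f 0) / t"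
      using eventually_at_right_less[of "0::real"] by eventually_elim simp
    show "\<forall>\<^sub>F t in at_right 0. norm (f t - t *\<^sub>R V t - f 0) / t
        \<le> norm (f t - f 0 - t *\<^sub>R V 0) / norm t + norm (V t - V 0)"
      using eventually_at_right_less[of "0::real"]
    proof eventually_elim
      case (elim t)
      have "f t - t *\<^sub>R V t - f 0 = (f t - f 0 - t *\<^sub>R V 0) - t *\<^sub>R (V t - V 0)"
        by (simp add: algebra_simps)
      then have "norm (f t - t *\<^sub>R V t - f 0)
          \<le> norm (f t - f 0 - t *\<^sub>R V 0) + norm (t *\<^sub>R (V t - V 0))"
        by (simp only: norm_triangle_ineq4)
      also have "norm (t *\<^sub>R (V t - V 0)) = t * norm (V t - V 0)" using elim by simp
      finally have "norm (f t - t *\<^sub>R V t - f 0) / t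
          \<le> (norm (f t - f 0 - t *\<^sub>R V 0) + t * norm (V t - V 0)) / t"
        using elim by (intro divide_right_mono) auto
      then show ?case using elim by (simp add: add_divide_distrib)
    qed
  qed
  show "\<forall>\<^sub>F t in at_right 0. (t::real) \<noteq> 0"
    using eventually_at_right_less[of "0::real"] by eventually_elim simp
qed

section \<open>Differentiating the curve of minimizers\<close>

context market
begin

text \<open>The explicit equilibrium built from winning bids has spend \<open>D $ i\<close> when the
  multiplier is one, so its positive leftover budget is \<open>b $ i - D $ i\<close>.\<close>

lemma strictly_unpaced_gradient:
  assumes min: "minimizer 0 \<beta>" and scs: "strict_comp_slack M b v s"
    and F: "GDERIV (revenue M v s) \<beta> :> D" and i: "\<beta> $ i = 1"
  shows "D $ i < b $ i"
proof -
  obtain k :: 'n where True by simp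
  have mix0: "mix_supply s s' 0 = s" by (simp add: mix_supply_def fun_eq_iff)
  have \<beta>: "\<And>j. 0 < \<beta> $ j \<and> \<beta> $ j \<le> 1" using min by (simp add: is_eg_minimizer_iff unit_box_def)
  have "GDERIV (\<lambda>x. revenue M v s x - log_barrier b x) \<beta> :> D - (\<chi> i. b $ i / \<beta> $ i)"
    using \<beta> by (intro GDERIV_diff F log_barrier_gradient) auto
  then have "GDERIV (mix_objective 0) \<beta> :> D - (\<chi> i. b $ i / \<beta> $ i)"
    by (simp add: mix0 eg_objective_revenue[abs_def])
  note stat = is_eg_minimizer_stationary[OF min this]
  have le: "\<beta> $ j * D $ j \<le> b $ j" for j
    using stat(1)[of j] \<beta>[of j] by (simp add: field_simps)
  have eq: "\<beta> $ j * D $ j = b $ j" if "\<beta> $ j < 1" for j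
    using stat(2)[OF that] \<beta>[of j] by (simp add: field_simps)
  note fppe = fppe_if_stationary[where b = b and k = k, OF s(1) F \<beta> le eq]
  have "0 < leftover M b s (\<lambda>\<theta>. max_bid v \<theta> \<beta>) (\<lambda>i \<theta>. of_bool (wins v k \<beta> \<theta> i)) i"
    using scs fppe(1) i unfolding strict_comp_slack_def by blast
  then show ?thesis using fppe(2) i by (simp add: leftover_def)
qed

text \<open>On one ball around \<open>\<beta>\<^sub>0\<close> and one range of \<alpha> the gradient
  \<open>F + \<alpha> \<Gamma>\<close> is strongly monotone with a common constant. Uniqueness,
  differentiability and continuity of the derivative are the three energy estimates applied
  there.\<close>

lemma multiplier_sensitivity:
  assumes min0: "minimizer 0 \<beta>\<^sub>0" and scs: "strict_comp_slack M b v s"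
    and U: "open U" "\<beta>\<^sub>0 \<in> U" "C2_on (revenue M v s) U"
    and U': "open U'" "\<beta>\<^sub>0 \<in> U'" "C2_on (eg_objective M b v s') U'"
  obtains a where "0 < a" "\<And>\<alpha>. \<bar>\<alpha>\<bar> < a \<Longrightarrow> \<exists>!\<beta>. minimizer \<alpha> \<beta>"
    "\<And>\<alpha>. \<bar>\<alpha>\<bar> < a \<Longrightarrow> ((\<lambda>\<alpha>. pacing M b v (mix_supply s s' \<alpha>)) has_vector_derivative
       surrogate_correction M b v s s' \<alpha>) (at \<alpha>)"
    "(surrogate_correction M b v s s' \<longlongrightarrow> surrogate_correction M b v s s' 0) (nhds 0)"
proof -
  obtain R DR where R: "\<And>x. x \<in> U \<Longrightarrow> GDERIV (revenue M v s) x :> R x"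
    and DR: "\<And>x. x \<in> U \<Longrightarrow> (R has_derivative blinfun_apply (DR x)) (at x)"
    and DR_cont: "continuous_on U DR"
    using C2_on_gradient[OF U(3)] by blast
  obtain G DG where G: "\<And>x. x \<in> U' \<Longrightarrow> GDERIV (eg_objective M b v s') x :> G x"
    and DG: "\<And>x. x \<in> U' \<Longrightarrow> (G has_derivative blinfun_apply (DG x)) (at x)"
    and DG_cont: "continuous_on U' DG"
    using C2_on_gradient[OF U'(3)] by blast
  define L :: "real^'n \<Rightarrow> real^'n" where "L x = (\<chi> i. b $ i / x $ i)" for x
  obtain DL where DL: "\<And>x. (\<And>i. 0 < x $ i) \<Longrightarrow> (L has_derivative blinfun_apply (DL x)) (at x)"
    and DL_cont: "continuous_on {x. \<forall>i. 0 < x $ i} DL"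
    and DL_eq: "\<And>x h. DL x h = (\<chi> i. - (b $ i / (x $ i)\<^sup>2) * h $ i)"
    using log_barrier_gradient_C1[of b] unfolding L_def[abs_def] by blast
  \<comment> \<open>An open set must pass beyond multipliers equal to one, but keeping coordinates
    below 2 bounds the barrier curvature \<open>b $ i / (x $ i)\<^sup>2\<close> from below by
    \<open>m / 4\<close>.\<close>
  define W where "W = U \<inter> U' \<inter> box 0 (vec 2)"
  have \<beta>\<^sub>0: "\<And>i. 0 < \<beta>\<^sub>0 $ i \<and> \<beta>\<^sub>0 $ i \<le> 1" using min0 by (simp add: is_eg_minimizer_iff unit_box_def)
  have W: "open W" "\<beta>\<^sub>0 \<in> W"
    unfolding W_def using U(1,2) U'(1,2) \<beta>\<^sub>0 by (auto simp: mem_box_cart intro: le_less_trans[of _ 1])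
  have WU: "x \<in> U" "x \<in> U'" and Wpos: "0 < x $ i" "x $ i < 2" if "x \<in> W" for x i
    using that by (auto simp: W_def mem_box_cart)
  define F where "F x = R x - L x" for x
  define DF where "DF x = DR x - DL x" for x
  \<comment> \<open>The \<alpha>-derivative of the gradient of the mixed objective. The barrier
    terms cancel in it, leaving a difference of revenue gradients.\<close>
  define \<Gamma> where "\<Gamma> x = G x - F x" for x
  define D\<Gamma> where "D\<Gamma> x = DG x - DF x" for x
  have L: "GDERIV (log_barrier b) x :> L x" if "x \<in> W" for x
    unfolding L_def using Wpos[OF that] by (intro log_barrier_gradient) auto
  have F: "GDERIV (eg_objective M b v s) x :> F x" if "x \<in> W" for x
    unfolding F_def eg_objective_revenue[abs_def] using L R WU that by (intro GDERIV_diff) auto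
  have rev': "GDERIV (revenue M v s') x :> G x + L x" if "x \<in> W" for x
  proof -
    have "GDERIV (\<lambda>x. eg_objective M b v s' x + log_barrier b x) x :> G x + L x"
      using G L WU that by (intro GDERIV_add) auto
    then show ?thesis by (simp add: eg_objective_revenue)
  qed
  have mix_grad: "GDERIV (mix_objective \<alpha>) x :> F x + \<alpha> *\<^sub>R \<Gamma> x" if "x \<in> W" for \<alpha> x
  proof -
    have "((\<lambda>y. eg_objective M b v s y + \<alpha> * (eg_objective M b v s' y - eg_objective M b v s y))
        has_derivative (\<lambda>h. h \<bullet> F x + \<alpha> * (h \<bullet> G x - h \<bullet> F x))) (at x)"
      using F[OF that] G[OF WU(2)[OF that]] unfolding gderiv_def
      by (intro has_derivative_add has_derivative_mult_right has_derivative_diff)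
    then show ?thesis
      unfolding gderiv_def mix_objective_affine[abs_def]
      by (rule has_derivative_eq_rhs) (simp add: \<Gamma>_def inner_add_right inner_diff_right)
  qed
  have DF: "(F has_derivative blinfun_apply (DF x)) (at x)" if "x \<in> W" for x
    unfolding F_def[abs_def] DF_def blinfun.diff_left
    using DR DL WU Wpos that by (intro has_derivative_diff) auto
  have D\<Gamma>: "(\<Gamma> has_derivative blinfun_apply (D\<Gamma> x)) (at x)" if "x \<in> W" for x
    unfolding \<Gamma>_def[abs_def] D\<Gamma>_def blinfun.diff_left
    using DG DF WU that by (intro has_derivative_diff) auto
  have DF_cont: "continuous_on W DF"
    unfolding DF_def[abs_def] using WU Wpos
    by (intro continuous_on_diff continuous_on_subset[OF DR_cont] continuous_on_subset[OF DL_cont]) auto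
  have D\<Gamma>_cont: "continuous_on W D\<Gamma>"
    unfolding D\<Gamma>_def[abs_def] using WU
    by (intro continuous_on_diff continuous_on_subset[OF DG_cont] DF_cont) auto
  have isCont_W: "isCont F x" "isCont \<Gamma> x" "isCont DF x" "isCont D\<Gamma> x" if "x \<in> W" for x
    using that has_derivative_continuous[OF DF] has_derivative_continuous[OF D\<Gamma>]
      DF_cont D\<Gamma>_cont W(1) by (auto simp: continuous_on_eq_continuous_at)
  obtain m where m: "0 < m" "\<And>i. m \<le> b $ i" using budgets_lower_bound by blast
  \<comment> \<open>The revenue Hessian contributes a nonnegative form by monotonicity; the barrier
    alone supplies the constant.\<close>
  have DF_coercive: "m / 4 * (h \<bullet> h) \<le> h \<bullet> DF x h" if x: "x \<in> W" for x h
  proof -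
    have "0 \<le> h \<bullet> DR x h"
      using DR[OF WU(1)[OF x]] U(1) WU(1)[OF x]
      by (rule has_derivative_monotone_nonneg)
        (use R WU(1)[OF x] in \<open>auto intro: revenue_gradient_monotone[OF s(1)]\<close>)
    moreover have "m / 4 * (h \<bullet> h) \<le> (\<Sum>i\<in>UNIV. b $ i / (x $ i)\<^sup>2 * (h $ i)\<^sup>2)"
      unfolding inner_vec_def sum_distrib_left
    proof (rule sum_mono)
      fix i
      have "(x $ i)\<^sup>2 \<le> 2\<^sup>2" using Wpos[OF x, of i] by (intro power_mono) auto
      then have "m / 4 \<le> b $ i / (x $ i)\<^sup>2"
        using m(1) m(2)[of i] Wpos(1)[OF x, of i] by (intro frac_le) auto
      then have "m / 4 * (h $ i)\<^sup>2 \<le> b $ i / (x $ i)\<^sup>2 * (h $ i)\<^sup>2" by (rule mult_right_mono) simp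
      then show "m / 4 * (h $ i \<bullet> h $ i) \<le> b $ i / (x $ i)\<^sup>2 * (h $ i)\<^sup>2"
        by (simp only: inner_real_def power2_eq_square[of "h $ i"])
    qed
    moreover have "h \<bullet> DL x h = - (\<Sum>i\<in>UNIV. b $ i / (x $ i)\<^sup>2 * (h $ i)\<^sup>2)"
      by (simp add: DL_eq inner_vec_def power2_eq_square sum_negf[symmetric] mult_ac)
    ultimately show ?thesis by (simp add: DF_def blinfun.diff_left inner_diff_right)
  qed
  have neg: "F \<beta>\<^sub>0 $ i < 0" if "\<beta>\<^sub>0 $ i = 1" for i
    using strictly_unpaced_gradient[OF min0 scs R[OF U(2)] that] that by (simp add: F_def L_def)
  \<comment> \<open>Half of the coercivity of \<open>DF\<close>; the other half absorbs
    \<open>\<alpha> D\<Gamma>\<close>.\<close>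
  define c where "c = m / 8"
  have c: "0 < c" using m by (simp add: c_def)
  have "\<forall>\<^sub>F z in nhds (0::real, \<beta>\<^sub>0). snd z \<in> W \<and> (\<forall>i. \<beta>\<^sub>0 $ i < 1 \<longrightarrow> snd z $ i < 1) \<and>
      (\<forall>i. \<beta>\<^sub>0 $ i = 1 \<longrightarrow> (F (snd z) + fst z *\<^sub>R \<Gamma> (snd z)) $ i < 0) \<and>
      norm (fst z *\<^sub>R D\<Gamma> (snd z)) < m / 8"
  proof (intro eventually_conj)
    have id: "((\<lambda>z. z) \<longlongrightarrow> (0::real, \<beta>\<^sub>0)) (nhds (0::real, \<beta>\<^sub>0))" by (rule filterlim_ident)
    have lim: "(fst \<longlongrightarrow> 0) (nhds (0::real, \<beta>\<^sub>0))" "(snd \<longlongrightarrow> \<beta>\<^sub>0) (nhds (0::real, \<beta>\<^sub>0))"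
      using tendsto_fst[OF id] tendsto_snd[OF id] by simp_all
    note comp = isCont_tendsto_compose[OF _ lim(2)]
    show "\<forall>\<^sub>F z in nhds (0::real, \<beta>\<^sub>0). snd z \<in> W"
      using topological_tendstoD[OF lim(2) W] by simp
    have "\<forall>\<^sub>F z in nhds (0::real, \<beta>\<^sub>0). \<beta>\<^sub>0 $ i < 1 \<longrightarrow> snd z $ i < 1" for i
      using order_tendstoD(2)[OF tendsto_vec_nth[OF lim(2), of i], of 1] by (cases "\<beta>\<^sub>0 $ i < 1") auto
    then show "\<forall>\<^sub>F z in nhds (0::real, \<beta>\<^sub>0). \<forall>i. \<beta>\<^sub>0 $ i < 1 \<longrightarrow> snd z $ i < 1"
      by (simp add: eventually_all_finite)
    have lim_grad: "((\<lambda>z. F (snd z) + fst z *\<^sub>R \<Gamma> (snd z)) \<longlongrightarrow> F \<beta>\<^sub>0 + 0 *\<^sub>R \<Gamma> \<beta>\<^sub>0) (nhds (0::real, \<beta>\<^sub>0))"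
      using W(2) by (intro tendsto_add tendsto_scaleR lim comp isCont_W)
    have "\<forall>\<^sub>F z in nhds (0::real, \<beta>\<^sub>0). \<beta>\<^sub>0 $ i = 1 \<longrightarrow> (F (snd z) + fst z *\<^sub>R \<Gamma> (snd z)) $ i < 0" for i
      using order_tendstoD(2)[OF tendsto_vec_nth[OF lim_grad, of i], of 0] neg[of i]
      by (cases "\<beta>\<^sub>0 $ i = 1") auto
    then show "\<forall>\<^sub>F z in nhds (0::real, \<beta>\<^sub>0). \<forall>i. \<beta>\<^sub>0 $ i = 1 \<longrightarrow> (F (snd z) + fst z *\<^sub>R \<Gamma> (snd z)) $ i < 0"
      by (simp only: eventually_all_finite)
    have "((\<lambda>z. norm (fst z *\<^sub>R D\<Gamma> (snd z))) \<longlongrightarrow> norm (0 *\<^sub>R D\<Gamma> \<beta>\<^sub>0)) (nhds (0::real, \<beta>\<^sub>0))"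
      using W(2) by (intro tendsto_norm tendsto_scaleR lim comp isCont_W)
    then show "\<forall>\<^sub>F z in nhds (0::real, \<beta>\<^sub>0). norm (fst z *\<^sub>R D\<Gamma> (snd z)) < m / 8"
      by (rule order_tendstoD) (use m in simp)
  qed
  \<comment> \<open>A neighbourhood of the pair contains a product, which makes the range of
    \<alpha> and the radius of the ball independent of each other.\<close>
  then obtain P Q where P: "eventually P (nhds (0::real))" and Q: "eventually Q (nhds \<beta>\<^sub>0)"
    and PQ: "\<And>\<alpha> x. P \<alpha> \<Longrightarrow> Q x \<Longrightarrow> x \<in> W \<and> (\<forall>i. \<beta>\<^sub>0 $ i < 1 \<longrightarrow> x $ i < 1) \<and>
      (\<forall>i. \<beta>\<^sub>0 $ i = 1 \<longrightarrow> (F x + \<alpha> *\<^sub>R \<Gamma> x) $ i < 0) \<and> norm (\<alpha> *\<^sub>R D\<Gamma> x) < m / 8"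
    unfolding nhds_prod eventually_prod_filter by auto
  obtain a\<^sub>0 where a\<^sub>0: "0 < a\<^sub>0" "\<And>\<alpha>. \<bar>\<alpha>\<bar> < a\<^sub>0 \<Longrightarrow> P \<alpha>"
    using P unfolding eventually_nhds_metric by (auto simp: dist_real_def)
  obtain r where r: "0 < r" "\<And>x. x \<in> ball \<beta>\<^sub>0 r \<Longrightarrow> Q x"
    using Q unfolding eventually_nhds_metric by (auto simp: dist_commute)
  obtain K where K: "0 \<le> K"
    "\<And>\<alpha> \<beta> \<gamma>. minimizer 0 \<beta> \<Longrightarrow> minimizer \<alpha> \<gamma> \<Longrightarrow> (norm (\<gamma> - \<beta>))\<^sup>2 \<le> K * \<bar>\<alpha>\<bar>"
    using minimizers_near by blast
  \<comment> \<open>The bound 1 secures existence of minimizers; \<open>r\<^sup>2 / (K + 1)\<close>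
    forces them into the ball through the square-root estimate.\<close>
  define a where "a = min a\<^sub>0 (min 1 (r\<^sup>2 / (K + 1)))"
  have a: "0 < a" using a\<^sub>0(1) r(1) K(1) by (simp add: a_def)
  note local = PQ[OF a\<^sub>0(2) r(2)]
  have a_a0: "\<bar>\<alpha>\<bar> < a\<^sub>0" if "\<bar>\<alpha>\<bar> < a" for \<alpha> using that by (simp add: a_def)
  have in_W: "x \<in> W" if "x \<in> ball \<beta>\<^sub>0 r" for x
    using local[of 0 x] that a\<^sub>0(1) by simp
  have coercive: "c * (h \<bullet> h) \<le> h \<bullet> (DF x h + \<alpha> *\<^sub>R D\<Gamma> x h)"
    if "\<bar>\<alpha>\<bar> < a" "x \<in> ball \<beta>\<^sub>0 r" for \<alpha> x h
  proof -
    have "\<bar>h \<bullet> (\<alpha> *\<^sub>R D\<Gamma> x) h\<bar> \<le> norm h * norm ((\<alpha> *\<^sub>R D\<Gamma> x) h)" by (rule Cauchy_Schwarz_ineq2)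
    also have "\<dots> \<le> norm h * (norm (\<alpha> *\<^sub>R D\<Gamma> x) * norm h)"
      by (intro mult_left_mono norm_blinfun) simp
    also have "\<dots> = norm (\<alpha> *\<^sub>R D\<Gamma> x) * (h \<bullet> h)"
      by (simp add: dot_square_norm power2_eq_square)
    also have "\<dots> \<le> m / 8 * (h \<bullet> h)"
      using local[OF a_a0[OF that(1)] that(2)] by (intro mult_right_mono) auto
    finally show ?thesis
      using DF_coercive[OF in_W[OF that(2)], of h]
      by (simp add: c_def inner_add_right blinfun.scaleR_left)
  qed
  have monotone: "c * ((y - x) \<bullet> (y - x)) \<le> ((F y + \<alpha> *\<^sub>R \<Gamma> y) - (F x + \<alpha> *\<^sub>R \<Gamma> x)) \<bullet> (y - x)"
    if "\<bar>\<alpha>\<bar> < a" "x \<in> ball \<beta>\<^sub>0 r" "y \<in> ball \<beta>\<^sub>0 r" for \<alpha> x y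
  proof (rule coercive_derivative_imp_strongly_monotone[where B = "ball \<beta>\<^sub>0 r"])
    show "((\<lambda>x. F x + \<alpha> *\<^sub>R \<Gamma> x) has_derivative (\<lambda>h. DF z h + \<alpha> *\<^sub>R D\<Gamma> z h)) (at z)"
      if "z \<in> ball \<beta>\<^sub>0 r" for z
      using in_W[OF that] by (intro has_derivative_add has_derivative_scaleR_right DF D\<Gamma>)
  qed (use that coercive in auto)
  \<comment> \<open>Defined by \<open>\<beta>\<^sub>0\<close> alone, so one test space serves all
    parameters.\<close>
  define S where "S = {h :: real^'n. \<forall>i. \<beta>\<^sub>0 $ i = 1 \<longrightarrow> h $ i = 0}"
  have S: "subspace S" by (auto simp: S_def subspace_def)
  have minimizer_local: "x \<in> ball \<beta>\<^sub>0 r" "\<beta>\<^sub>0 $ i = 1 \<Longrightarrow> x $ i = 1" "\<beta>\<^sub>0 $ i < 1 \<Longrightarrow> x $ i < 1"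
    "h \<in> S \<Longrightarrow> h \<bullet> (F x + \<alpha> *\<^sub>R \<Gamma> x) = 0"
    if \<alpha>: "\<bar>\<alpha>\<bar> < a" and x: "minimizer \<alpha> x" for \<alpha> x i h
  proof -
    have "(norm (x - \<beta>\<^sub>0))\<^sup>2 \<le> K * \<bar>\<alpha>\<bar>" by (rule K(2)[OF min0 x])
    also have "\<dots> \<le> (K + 1) * \<bar>\<alpha>\<bar>" by (simp add: mult_right_mono)
    also have "\<dots> < r\<^sup>2" using \<alpha> K(1) by (simp add: a_def field_simps)
    finally have "norm (x - \<beta>\<^sub>0) < r" using r(1) by (simp add: power2_less_imp_less)
    then show ball: "x \<in> ball \<beta>\<^sub>0 r" by (simp add: dist_norm norm_minus_commute)
    note loc = local[OF a_a0[OF \<alpha>] ball]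
    note stat = is_eg_minimizer_stationary[OF x mix_grad[OF in_W[OF ball]]]
    have box: "x $ j \<le> 1" for j using x by (simp add: is_eg_minimizer_iff unit_box_def)
    \<comment> \<open>A coordinate below one would have zero partial derivative, but on the ball
      this derivative is negative.\<close>
    have one: "x $ j = 1" if "\<beta>\<^sub>0 $ j = 1" for j
      using stat(2)[of j] loc that box[of j] by (metis less_irrefl order_le_less)
    then show "\<beta>\<^sub>0 $ i = 1 \<Longrightarrow> x $ i = 1" .
    show "\<beta>\<^sub>0 $ i < 1 \<Longrightarrow> x $ i < 1" using loc by blast
    assume "h \<in> S"
    then have "h $ j * (F x + \<alpha> *\<^sub>R \<Gamma> x) $ j = 0" for j
      using stat(2)[of j] loc \<beta>\<^sub>0[of j] by (cases "\<beta>\<^sub>0 $ j = 1") (auto simp: S_def)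
    then show "h \<bullet> (F x + \<alpha> *\<^sub>R \<Gamma> x) = 0" by (simp only: inner_vec_def inner_real_def sum.neutral_const)
  qed
  have diff_S: "y - x \<in> S" if "\<bar>\<alpha>\<bar> < a" "minimizer \<alpha> x" "\<bar>\<alpha>'\<bar> < a" "minimizer \<alpha>' y" for \<alpha> \<alpha>' x y
    using minimizer_local(2)[OF that(1,2)] minimizer_local(2)[OF that(3,4)] by (simp add: S_def)
  have lip: "norm (y - x) \<le> norm (\<Gamma> x) / c * \<bar>\<alpha>' - \<alpha>\<bar>"
    if "\<bar>\<alpha>\<bar> < a" "minimizer \<alpha> x" "\<bar>\<alpha>'\<bar> < a" "minimizer \<alpha>' y" for \<alpha> \<alpha>' x y
    using c monotone[OF that(3) minimizer_local(1)[OF that(1,2)] minimizer_local(1)[OF that(3,4)]]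
  proof (rule stationary_curve_Lipschitz)
    show "(F x + \<alpha> *\<^sub>R \<Gamma> x) \<bullet> (y - x) = 0" "(F y + \<alpha>' *\<^sub>R \<Gamma> y) \<bullet> (y - x) = 0"
      using minimizer_local(4)[OF that(1,2) diff_S[OF that]] minimizer_local(4)[OF that(3,4) diff_S[OF that]]
      by (simp_all add: inner_commute)
  qed
  have ex1: "\<exists>!x. minimizer \<alpha> x" if "\<bar>\<alpha>\<bar> < a" for \<alpha>
  proof (rule ex_ex1I)
    show "\<exists>x. minimizer \<alpha> x" using that by (intro minimizer_exists) (simp add: a_def)
    \<comment> \<open>The Lipschitz bound between minimizers, taken at equal parameters.\<close>
    show "x = y" if "minimizer \<alpha> x" "minimizer \<alpha> y" for x y
      using lip[OF \<open>\<bar>\<alpha>\<bar> < a\<close> that(2) \<open>\<bar>\<alpha>\<bar> < a\<close> that(1)] by simp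
  qed
  define \<beta> where "\<beta> \<alpha> = pacing M b v (mix_supply s s' \<alpha>)" for \<alpha>
  have \<beta>: "minimizer \<alpha> (\<beta> \<alpha>)" if "\<bar>\<alpha>\<bar> < a" for \<alpha>
    unfolding \<beta>_def pacing_def by (rule theI'[OF ex1[OF that]])
  define V where "V = surrogate_correction M b v s s'"
  define H where "H \<alpha> = DF (\<beta> \<alpha>) + \<alpha> *\<^sub>R D\<Gamma> (\<beta> \<alpha>)" for \<alpha>
  have H: "blinfun_apply (H \<alpha>) h = DF (\<beta> \<alpha>) h + \<alpha> *\<^sub>R D\<Gamma> (\<beta> \<alpha>) h" for \<alpha> h
    by (simp add: H_def blinfun.add_left blinfun.scaleR_left)
  have V: "V \<alpha> \<in> S" "h \<in> S \<Longrightarrow> h \<bullet> H \<alpha> (V \<alpha>) = - (h \<bullet> \<Gamma> (\<beta> \<alpha>))" if \<alpha>: "\<bar>\<alpha>\<bar> < a" for \<alpha> h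
  proof -
    note ball = minimizer_local(1)[OF \<alpha> \<beta>[OF \<alpha>]]
    note inW = in_W[OF ball]
    define P where "P = unpaced_proj (\<beta> \<alpha>)"
    define A where "A = hess (mix_objective \<alpha>) (\<beta> \<alpha>)"
    \<comment> \<open>The unpaced coordinates at \<open>\<beta> \<alpha>\<close> are those at
      \<open>\<beta>\<^sub>0\<close>, so \<open>P\<close> is the orthogonal projection onto
      \<open>S\<close>.\<close>
    have P: "(P *v h) $ i = (if \<beta>\<^sub>0 $ i = 1 then 0 else h $ i)" for h i
      using minimizer_local(2,3)[OF \<alpha> \<beta>[OF \<alpha>], of i] \<beta>\<^sub>0[of i]
      by (auto simp: P_def unpaced_proj_mult_vec less_le)
    have PS: "h \<in> S \<longleftrightarrow> P *v h = h" for h by (auto simp: S_def vec_eq_iff P)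
    have A: "A *v h = H \<alpha> h" for h
      unfolding A_def H
      by (rule hess_mult_vec[OF W(1) inW mix_grad])
        (use inW in \<open>auto intro!: has_derivative_add has_derivative_scaleR_right DF D\<Gamma>\<close>)
    have pos: "0 < h \<bullet> (A *v h)" if "h \<noteq> 0" for h
      using coercive[OF \<alpha> ball, of h] that c by (simp add: A H) (smt (verit) inner_gt_zero_iff mult_pos_pos)
    have pinv: "P ** pinv (P ** A ** P) = pinv (P ** A ** P)" "P ** A ** pinv (P ** A ** P) = P"
      using pos by (intro pinv_compression; simp add: P_def unpaced_proj_idem unpaced_proj_transpose)+
    \<comment> \<open>The shift weighs items by \<open>s - s'\<close>, whereas the mixture moves in
      direction \<open>s' - s\<close> as \<alpha> grows; hence the sign.\<close>
    have shift: "supply_shift M v s s' (\<beta> \<alpha>) = - \<Gamma> (\<beta> \<alpha>)"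
      using supply_shift_eq[OF s(1) s'(1) Wpos(1)[OF inW] R[OF WU(1)[OF inW]] rev'[OF inW]]
      by (simp add: \<Gamma>_def F_def)
    have V_eq: "V \<alpha> = pinv (P ** A ** P) *v (- \<Gamma> (\<beta> \<alpha>))"
      unfolding V_def surrogate_correction_def Let_def shift[symmetric]
      by (simp add: P_def A_def \<beta>_def)
    show "V \<alpha> \<in> S"
      unfolding PS V_eq by (simp only: matrix_vector_mul_assoc pinv(1))
    assume h: "h \<in> S"
    have inner_P: "h \<bullet> (P *v y) = h \<bullet> y" for y
      using h unfolding inner_vec_def P S_def by (intro sum.cong) auto
    have "h \<bullet> H \<alpha> (V \<alpha>) = h \<bullet> (P *v (A *v V \<alpha>))" by (simp add: inner_P A)
    also have "P *v (A *v V \<alpha>) = P *v (- \<Gamma> (\<beta> \<alpha>))"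
      unfolding V_eq by (simp only: matrix_vector_mul_assoc matrix_mul_assoc pinv(2))
    finally show "h \<bullet> H \<alpha> (V \<alpha>) = - (h \<bullet> \<Gamma> (\<beta> \<alpha>))" by (simp add: inner_P)
  qed
  have deriv: "(\<beta> has_vector_derivative V \<alpha>) (at \<alpha>)" if \<alpha>: "\<bar>\<alpha>\<bar> < a" for \<alpha>
  proof (rule stationary_curve_has_vector_derivative[OF c, where A = "ball 0 a" and S = S])
    note ball = minimizer_local(1)[OF \<alpha> \<beta>[OF \<alpha>]]
    show "(F has_derivative blinfun_apply (DF (\<beta> \<alpha>))) (at (\<beta> \<alpha>))"
      "(\<Gamma> has_derivative blinfun_apply (D\<Gamma> (\<beta> \<alpha>))) (at (\<beta> \<alpha>))"
      by (rule DF[OF in_W[OF ball]], rule D\<Gamma>[OF in_W[OF ball]])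
    show "c * (h \<bullet> h) \<le> h \<bullet> (DF (\<beta> \<alpha>) h + \<alpha> *\<^sub>R D\<Gamma> (\<beta> \<alpha>) h)" for h
      by (rule coercive[OF \<alpha> ball])
    show "\<beta> \<alpha>' - \<beta> \<alpha> \<in> S" "norm (\<beta> \<alpha>' - \<beta> \<alpha>) \<le> norm (\<Gamma> (\<beta> \<alpha>)) / c * \<bar>\<alpha>' - \<alpha>\<bar>"
      if "\<alpha>' \<in> ball 0 a" for \<alpha>'
    proof -
      have \<alpha>': "\<bar>\<alpha>'\<bar> < a" using that by simp
      show "\<beta> \<alpha>' - \<beta> \<alpha> \<in> S" "norm (\<beta> \<alpha>' - \<beta> \<alpha>) \<le> norm (\<Gamma> (\<beta> \<alpha>)) / c * \<bar>\<alpha>' - \<alpha>\<bar>"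
        by (rule diff_S[OF \<alpha> \<beta>[OF \<alpha>] \<alpha>' \<beta>[OF \<alpha>']], rule lip[OF \<alpha> \<beta>[OF \<alpha>] \<alpha>' \<beta>[OF \<alpha>']])
    qed
    show "h \<bullet> (F (\<beta> \<alpha>') + \<alpha>' *\<^sub>R \<Gamma> (\<beta> \<alpha>')) = 0" if "\<alpha>' \<in> ball 0 a" "h \<in> S" for \<alpha>' h
      using minimizer_local(4)[OF _ \<beta> that(2)] that(1) by simp
    show "h \<bullet> (DF (\<beta> \<alpha>) (V \<alpha>) + \<alpha> *\<^sub>R D\<Gamma> (\<beta> \<alpha>) (V \<alpha>)) = - (h \<bullet> \<Gamma> (\<beta> \<alpha>))" if "h \<in> S" for h
      using V(2)[OF \<alpha> that] by (simp add: H)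
  qed (use S \<alpha> V(1) in auto)
  have ev: "\<forall>\<^sub>F \<alpha> in nhds 0. \<bar>\<alpha>\<bar> < a"
    using a unfolding eventually_nhds_metric by (auto simp: dist_real_def)
  have \<beta>lim: "(\<beta> \<longlongrightarrow> \<beta> 0) (nhds 0)"
    using has_vector_derivative_continuous[OF deriv[of 0]] a by (simp add: isCont_def tendsto_at_iff_tendsto_nhds)
  have \<beta>0: "\<beta> 0 \<in> W" using a by (intro in_W minimizer_local(1)[OF _ \<beta>, of 0]) simp_all
  have V_lim: "(V \<longlongrightarrow> V 0) (nhds 0)"
  proof (rule coercive_solution_tendsto[OF c S, where H = H and \<delta> = "\<lambda>\<alpha>. - \<Gamma> (\<beta> \<alpha>)"])
    show "\<forall>\<^sub>F \<alpha> in nhds 0. \<forall>h. c * (h \<bullet> h) \<le> h \<bullet> H \<alpha> h"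
      using ev by eventually_elim (use coercive[OF _ minimizer_local(1)[OF _ \<beta>]] in \<open>simp add: H\<close>)
    show "\<forall>\<^sub>F \<alpha> in nhds 0. V \<alpha> \<in> S \<and> (\<forall>h\<in>S. h \<bullet> H \<alpha> (V \<alpha>) = h \<bullet> - \<Gamma> (\<beta> \<alpha>))"
      using ev by eventually_elim (use V in auto)
    show "(H \<longlongrightarrow> H 0) (nhds 0)"
      unfolding H_def[abs_def] using isCont_W[OF \<beta>0]
      by (intro tendsto_add tendsto_scaleR filterlim_ident isCont_tendsto_compose[OF _ \<beta>lim])
    show "((\<lambda>\<alpha>. - \<Gamma> (\<beta> \<alpha>)) \<longlongrightarrow> - \<Gamma> (\<beta> 0)) (nhds 0)"
      using isCont_W[OF \<beta>0] by (intro tendsto_minus isCont_tendsto_compose[OF _ \<beta>lim])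
  qed
  show thesis
    using that[OF a ex1] deriv V_lim unfolding \<beta>_def[abs_def] V_def by blast
qed

end

theorem theorem1:
  fixes M :: "'t measure" and b :: "real^'n" and v :: "'n::finite \<Rightarrow> 't \<Rightarrow> real"
    and s s' :: "'t \<Rightarrow> real" and Good Bad :: "'t set" and \<beta>star :: "real \<Rightarrow> real^'n"
  defines "\<beta>star \<equiv> (\<lambda>\<alpha>. pacing M b v (mix_supply s s' \<alpha>))"
  assumes budgets: "\<And>i. 0 < b $ i"
    and val_nonneg: "\<And>i \<theta>. \<theta> \<in> space M \<Longrightarrow> 0 \<le> v i \<theta>"
    and val_L1: "\<And>i. L1_plus M (v i)"
    and val_bdd: "\<exists>C. \<forall>i. \<forall>\<theta>\<in>space M. v i \<theta> \<le> C"
    and items: "Good \<in> sets M" "Bad \<in> sets M" "Good \<inter> Bad = {}" "Good \<union> Bad = space M"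
    and supply_s: "Linf_plus M s" "(\<integral>\<theta>. s \<theta> \<partial>M) = 1" "AE \<theta> in M. \<theta> \<in> Bad \<longrightarrow> s \<theta> = 0"
    and supply_s': "Linf_plus M s'" "(\<integral>\<theta>. s' \<theta> \<partial>M) = 1" "AE \<theta> in M. \<theta> \<in> Good \<longrightarrow> s' \<theta> = 0"
    and smooth: "\<exists>U. open U \<and> \<beta>star 0 \<in> U \<and> C2_on (\<lambda>\<beta>. \<integral>\<theta>. max_bid v \<theta> \<beta> * s \<theta> \<partial>M) U"
    and scs: "strict_comp_slack M b v s"
    and smooth': "\<exists>U. open U \<and> \<beta>star 0 \<in> U \<and>
                    C2_on (eg_objective M b v s') U \<and> C2_on (hess (eg_objective M b v s')) U"
  shows "(\<forall>\<^sub>F \<alpha> in nhds 0.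
            (\<exists>!\<beta>. is_eg_minimizer M b v (mix_supply s s' \<alpha>) \<beta>) \<and>
            ((\<lambda>\<epsilon>. (\<beta>star (\<alpha> - \<epsilon>) - \<beta>star \<alpha>) /\<^sub>R \<epsilon>)
               \<longlongrightarrow> - surrogate_correction M b v s s' \<alpha>) (at_right 0)) \<and>
         (\<lambda>\<alpha>. norm (\<beta>star \<alpha> - \<alpha> *\<^sub>R surrogate_correction M b v s s' \<alpha> - \<beta>star 0))
           \<in> o[at_right 0](\<lambda>\<alpha>. \<alpha>)"
proof -
  interpret market M v b s s'
    by unfold_locales (use assms in \<open>auto simp: L1_plus_def\<close>)
  obtain \<beta>\<^sub>0 where \<beta>\<^sub>0: "minimizer 0 \<beta>\<^sub>0" using minimizer_exists[of 0] by auto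
  \<comment> \<open>The smoothness hypotheses are centred at a definite description, which must be
    identified with an actual minimizer before they can be used.\<close>
  have star0: "\<beta>star 0 = \<beta>\<^sub>0"
    unfolding \<beta>star_def using minimizer_0_unique[OF \<beta>\<^sub>0] \<beta>\<^sub>0 by (rule pacing_eq_minimizer)
  obtain U where U: "open U" "\<beta>\<^sub>0 \<in> U" "C2_on (revenue M v s) U"
    using smooth unfolding star0 revenue_def[abs_def] by blast
  obtain U' where U': "open U'" "\<beta>\<^sub>0 \<in> U'" "C2_on (eg_objective M b v s') U'"
    using smooth' unfolding star0 by blast
  obtain a where a: "0 < a" "\<And>\<alpha>. \<bar>\<alpha>\<bar> < a \<Longrightarrow> \<exists>!\<beta>. minimizer \<alpha> \<beta>"
    and deriv: "\<And>\<alpha>. \<bar>\<alpha>\<bar> < a \<Longrightarrow>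
      (\<beta>star has_vector_derivative surrogate_correction M b v s s' \<alpha>) (at \<alpha>)"
    and lim: "(surrogate_correction M b v s s' \<longlongrightarrow> surrogate_correction M b v s s' 0) (nhds 0)"
    using multiplier_sensitivity[OF \<beta>\<^sub>0 scs U U'] unfolding \<beta>star_def by blast
  have "\<forall>\<^sub>F \<alpha> in nhds 0. \<bar>\<alpha>\<bar> < a"
    using a(1) unfolding eventually_nhds_metric by (auto simp: dist_real_def)
  then have "\<forall>\<^sub>F \<alpha> in nhds 0. (\<exists>!\<beta>. minimizer \<alpha> \<beta>) \<and>
      ((\<lambda>\<epsilon>. (\<beta>star (\<alpha> - \<epsilon>) - \<beta>star \<alpha>) /\<^sub>R \<epsilon>)
        \<longlongrightarrow> - surrogate_correction M b v s s' \<alpha>) (at_right 0)"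
    by eventually_elim (use a(2) has_vector_derivative_imp_backward_quotient[OF deriv] in blast)
  moreover have "(\<lambda>\<alpha>. norm (\<beta>star \<alpha> - \<alpha> *\<^sub>R surrogate_correction M b v s s' \<alpha> - \<beta>star 0))
      \<in> o[at_right 0](\<lambda>\<alpha>. \<alpha>)"
    by (rule first_order_expansion_at_moving_point[OF deriv lim]) (use a(1) in simp)
  ultimately show ?thesis by blast
qed

end
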